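(* Let $\mathbb{C}=\{C(t),t\ge 0\}$ be the stationary Markov process of the open network of queues described in the context, defined by the transition rates (A), (B), (C) given there, and let $N_j(t)$ be the queue length at node $j$ at time $t$, $j=1,\ldots,J$. Put $$\alpha_j(i,s)=\begin{cases} v(i), & \text{if } r(i,s)=j,\\ 0, & \text{in other cases,}\end{cases}\qquad b_j=\sum_{i=1}^{I}\sum_{s=1}^{f(i)}\alpha_j(i,s),\qquad B_j^{-1}=\sum_{n=0}^{\infty}\frac{b_j^{\,n}}{\prod_{l=1}^{n}\mu_j(l)}.$$ Then the stationary queue lengths $N_j(t)$, $j=1,2,\ldots,J$, are, for each $t$, mutually independent and, in equilibrium, their stationary probabilities are $$P[N_j(t)=n_j]=\pi_j(n_j)=\frac{B_j\,b_j^{\,n_j}}{\prod_{l=1}^{n_j}\mu_j(l)}.$$ Moreover, if a customer occupies position $l$ at node $j$, the probability that it is of type $i$ and is in stage $s$ of its path is $\dfrac{\alpha_j(i,s)}{b_j}$.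
   Context: Open network of queues with several customer types. There are $J<\infty$ nodes; node $j$ has waiting capacity $L_j<\infty$, $j=1,\ldots,J$. There are $I<\infty$ customer types, and the path of a customer is fixed by its type: a type $i$ customer follows the path $r(i,1),r(i,2),\ldots,r(i,f(i))$, where $r(i,s)$ is the $s$-th node visited by type $i$ customers and $r(i,f(i))$ is the last one before leaving the network. The type of a customer does not change during its sojourn in the network. Type $i$ customers arrive at the network from outside according to a Poisson process with parameter $v(i)$, $i=1,\ldots,I$. At the nodes, customers have exponentially distributed service requirements; with no loss of generality the mean service requirement is supposed unitary. All service requirements of all customers at all nodes are mutually independent and independent of the arrival processes. If there are $n_j$ customers at node $j$, they are in positions $1,\ldots,n_j$, and: - the expected service requirement for the customer in position $l$ is $\mu_j^{-1}(l)$, $l=1,\ldots,n_j$, with $\mu_j(l)>0$ if $n_j>0$; - the service velocity given to the customer in position $l$ is $\gamma_j(n_j,l)$, which depends on $n_j$, with $\sum_l\gamma_j(n_j,l)=1$; - when the customer in position $l$ leaves the node, the customers in positions $l+1,\ldots,n_j$ move to positions $l,\ldots,n_j-1$ respectively; - a customer arriving at node $j$ occupies position $l$ with probability $\delta_j(n_j+1,l)$, and the customers that were in positions $l,\ldots,n_j$ move to positions $l+1,\ldots,n_j+1$ respectively; $\sum_l\delta_j(n_j,l)=1$. State: $t_j(l)$ is the type of the customer in position $l$ at node $j$, and $s_j(l)$ is the stage of its path it has reached when at node $j$. Put $c_j(l)=(t_j(l),s_j(l))$, $c_j=(c_j(1),\ldots,c_j(n_j))$, $C=(c_1,\ldots,c_J)$;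 $C(t)=C$ means that the network is in state $C$ at instant $t$. The process $\mathbb{C}=\{C(t),t\ge0\}$ is a continuous-time Markov chain with countable state space. Its possible transitions are of three kinds: - $T_{jlr}C$ is the state after the customer in position $l$ at node $j$ moves to position $r$ in the next node of its path, with its stage becoming $s_j(l)+1$ (the next node may be $j$ itself: feedback); - $T_{jl\cdot}C$ is the state after a type $i$ customer in position $l$ at node $j=r(i,f(i))$, the last node of its path, leaves the network; - $T^{ir}C$ is the state after a type $i$ customer enters the network from outside, occupying position $r$ at node $r(i,1)$. Transition rates: (A) $q(C,T_{jlr}C)=\sum_g\sum_h\mu_j(g)\gamma_j(n_j,g)\delta_k(n_k+1,h)$ if the next node is $k\ne j$, and $q(C,T_{jlr}C)=\sum_g\sum_h\mu_j(g)\gamma_j(n_j,g)\delta_j(n_j,h)$ if the next node is $j$; the double sum is over all $g,h$ such that $T_{jlr}C=T_{jgh}C$. (B) $q(C,T_{jl\cdot}C)=\sum_g\mu_j(g)\gamma_j(n_j,g)$, the sum being over all $g$ for which $T_{jl\cdot}C=T_{jg\cdot}C$. (C) $q(C,T^{ir}C)=\sum_h v(i)\,\delta_k(n_k+1,h)$ with $k=r(i,1)$, the sum being over all $h$ for which $T^{ir}C=T^{ih}C$.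
   Formalization: Added: Σ_l μ_j(l)γ_j(n,l)=μ_j(n) for all j and n≥1 (false otherwise: FIFO, v=1, μ(1)=2, μ(l)=4 for l≥2 gives π(2)/π(1)=1/2, not 1/4), and convergence of the series for B_j^{-1}. The finite capacities L_j, which would contradict the formula, are dropped (queues unbounded). *)

theory Defs
  imports "HOL-Probability.Probability"
begin

section \<open>Markov processes in continuous time with given transition rates\<close>

definition transition_function :: "'s set \<Rightarrow> (real \<Rightarrow> 's \<Rightarrow> 's \<Rightarrow> real) \<Rightarrow> bool" where
  "transition_function S P \<longleftrightarrow>
     (\<forall>t\<ge>0. \<forall>x\<in>S. \<forall>y\<in>S. 0 \<le> P t x y) \<and>
     (\<forall>t\<ge>0. \<forall>x\<in>S. (P t x has_sum 1) S) \<and>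
     (\<forall>x\<in>S. \<forall>y\<in>S. P 0 x y = of_bool (x = y)) \<and>
     (\<forall>t\<ge>0. \<forall>u\<ge>0. \<forall>x\<in>S. \<forall>y\<in>S. ((\<lambda>z. P t x z * P u z y) has_sum P (t + u) x y) S)"

text \<open>Only the off-diagonal values of \<open>q\<close> are used: the diagonal of the generator is minus the
  total rate out of the state (conservative rates).\<close>

definition has_rates :: "'s set \<Rightarrow> (real \<Rightarrow> 's \<Rightarrow> 's \<Rightarrow> real) \<Rightarrow> ('s \<Rightarrow> 's \<Rightarrow> real) \<Rightarrow> bool" where
  "has_rates S P q \<longleftrightarrow>
     (\<forall>x\<in>S. \<forall>y\<in>S.
        ((\<lambda>h. (P h x y - P 0 x y) / h) \<longlongrightarrow>
           (if x = y then - infsum (q x) (S - {x}) else q x y)) (at_right 0))"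

text \<open>The last clause is the time-homogeneous Markov property
  \<open>P(X(u (m+1)) = x (m+1) | X(u 0) = x 0, ..., X(u m) = x m) = P (u (m+1) - u m) (x m) (x (m+1))\<close>,
  multiplied out so that conditioning events of probability zero need no exception.\<close>

definition markov_process ::
  "'w measure \<Rightarrow> 's set \<Rightarrow> ('s \<Rightarrow> 's \<Rightarrow> real) \<Rightarrow> (real \<Rightarrow> 'w \<Rightarrow> 's) \<Rightarrow> bool" where
  "markov_process M S q X \<longleftrightarrow>
     prob_space M \<and> countable S \<and>
     (\<forall>t\<ge>0. X t \<in> measurable M (count_space S)) \<and>
     (\<exists>P. transition_function S P \<and> has_rates S P q \<and>
        (\<forall>m (u :: nat \<Rightarrow> real) x. 0 \<le> u 0 \<and> (\<forall>k\<le>m. u k < u (Suc k)) \<and> (\<forall>k\<le>Suc m. x k \<in> S) \<longrightarrow>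
           \<P>(\<omega> in M. \<forall>k\<le>Suc m. X (u k) \<omega> = x k) =
           \<P>(\<omega> in M. \<forall>k\<le>m. X (u k) \<omega> = x k) * P (u (Suc m) - u m) (x m) (x (Suc m))))"

text \<open>Strict stationarity; for processes with a countable state space the probabilities of the
  events below determine the finite-dimensional distributions.\<close>

definition stationary_process :: "'w measure \<Rightarrow> (real \<Rightarrow> 'w \<Rightarrow> 's) \<Rightarrow> bool" where
  "stationary_process M X \<longleftrightarrow>
     (\<forall>T h x. finite T \<and> T \<subseteq> {0..} \<and> h \<ge> 0 \<longrightarrow>
        \<P>(\<omega> in M. \<forall>t\<in>T. X (t + h) \<omega> = x t) = \<P>(\<omega> in M. \<forall>t\<in>T. X t \<omega> = x t))"


section \<open>The network\<close>

text \<open>The customer types are the elements of the finite type \<open>'i\<close> and the nodes those of the finite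
  type \<open>'j\<close>.  In the notation of the mathematics, \<open>arr\<close> is \<open>v(i)\<close>, \<open>route\<close> is \<open>r(i,s)\<close> for
  \<open>1 \<le> s \<le> f(i)\<close>, \<open>len\<close> is \<open>f(i)\<close>, \<open>srv\<close> is \<open>\<mu>\<^sub>j(l)\<close>, \<open>vel\<close> is \<open>\<gamma>\<^sub>j(n,l)\<close> and \<open>ins\<close> is
  \<open>\<delta>\<^sub>j(n,l)\<close>.  Stages and positions are counted from 1; values outside these ranges are irrelevant.\<close>

record ('i, 'j) network =
  arr :: "'i \<Rightarrow> real"
  route :: "'i \<Rightarrow> nat \<Rightarrow> 'j"
  len :: "'i \<Rightarrow> nat"
  srv :: "'j \<Rightarrow> nat \<Rightarrow> real"
  vel :: "'j \<Rightarrow> nat \<Rightarrow> nat \<Rightarrow> real"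
  ins :: "'j \<Rightarrow> nat \<Rightarrow> nat \<Rightarrow> real"

definition open_network :: "('i, 'j) network \<Rightarrow> bool" where
  "open_network N \<longleftrightarrow>
     (\<forall>i. arr N i > 0) \<and>
     (\<forall>i. len N i \<ge> 1) \<and>
     (\<forall>j l. l \<ge> 1 \<longrightarrow> srv N j l > 0) \<and>
     (\<forall>j n l. 1 \<le> l \<and> l \<le> n \<longrightarrow> vel N j n l \<ge> 0) \<and>
     (\<forall>j n. n \<ge> 1 \<longrightarrow> (\<Sum>l=1..n. vel N j n l) = 1) \<and>
     (\<forall>j n l. 1 \<le> l \<and> l \<le> n \<longrightarrow> ins N j n l \<ge> 0) \<and>
     (\<forall>j n. n \<ge> 1 \<longrightarrow> (\<Sum>l=1..n. ins N j n l) = 1)"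

text \<open>A state assigns to node \<open>j\<close> the list \<open>c\<^sub>j = (c\<^sub>j(1), ..., c\<^sub>j(n\<^sub>j))\<close> of pairs (type, stage).\<close>

type_synonym ('i, 'j) state = "'j \<Rightarrow> ('i \<times> nat) list"

abbreviation queue_length :: "('i, 'j) state \<Rightarrow> 'j \<Rightarrow> nat" where
  "queue_length C j \<equiv> length (C j)"

definition customer :: "('i, 'j) state \<Rightarrow> 'j \<Rightarrow> nat \<Rightarrow> 'i \<times> nat" where
  "customer C j l = C j ! (l - 1)"

definition states :: "('i, 'j) network \<Rightarrow> ('i, 'j) state set" where
  "states N = {C. \<forall>j. \<forall>(i, s) \<in> set (C j). 1 \<le> s \<and> s \<le> len N i \<and> route N i s = j}"


subsection \<open>Transitions\<close>

definition remove_at :: "nat \<Rightarrow> 'a list \<Rightarrow> 'a list" where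
  "remove_at l xs = take (l - 1) xs @ drop l xs"

definition insert_at :: "nat \<Rightarrow> 'a \<Rightarrow> 'a list \<Rightarrow> 'a list" where
  "insert_at l x xs = take (l - 1) xs @ x # drop (l - 1) xs"

definition next_node :: "('i, 'j) network \<Rightarrow> ('i, 'j) state \<Rightarrow> 'j \<Rightarrow> nat \<Rightarrow> 'j" where
  "next_node N C j l = (case customer C j l of (i, s) \<Rightarrow> route N i (s + 1))"

text \<open>\<open>move N C j l r\<close>, \<open>leave C j l\<close> and \<open>enter N C i r\<close> are the states \<open>T\<^sub>j\<^sub>l\<^sub>r C\<close>, \<open>T\<^sub>j\<^sub>l\<^sub>. C\<close> and
  \<open>T\<^sup>i\<^sup>r C\<close>.  A customer fed back to its own node is first removed from its position.\<close>

definition move :: "('i, 'j) network \<Rightarrow> ('i, 'j) state \<Rightarrow> 'j \<Rightarrow> nat \<Rightarrow> nat \<Rightarrow> ('i, 'j) state" where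
  "move N C j l r =
     (let (i, s) = customer C j l; k = next_node N C j l; C' = C(j := remove_at l (C j))
      in C'(k := insert_at r (i, s + 1) (C' k)))"

definition leave :: "('i, 'j) state \<Rightarrow> 'j \<Rightarrow> nat \<Rightarrow> ('i, 'j) state" where
  "leave C j l = C(j := remove_at l (C j))"

definition enter :: "('i, 'j) network \<Rightarrow> ('i, 'j) state \<Rightarrow> 'i \<Rightarrow> nat \<Rightarrow> ('i, 'j) state" where
  "enter N C i r = (let k = route N i 1 in C(k := insert_at r (i, 1) (C k)))"

text \<open>Number of customers at the destination, including the one that moves there.\<close>

definition dest_length :: "('i, 'j) network \<Rightarrow> ('i, 'j) state \<Rightarrow> 'j \<Rightarrow> nat \<Rightarrow> nat" where
  "dest_length N C j l =
     (let k = next_node N C j l in if k = j then queue_length C j else queue_length C k + 1)"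

definition can_move :: "('i, 'j) network \<Rightarrow> ('i, 'j) state \<Rightarrow> 'j \<Rightarrow> nat \<Rightarrow> nat \<Rightarrow> bool" where
  "can_move N C j l r \<longleftrightarrow> 1 \<le> l \<and> l \<le> queue_length C j \<and>
     (case customer C j l of (i, s) \<Rightarrow> s < len N i) \<and> 1 \<le> r \<and> r \<le> dest_length N C j l"

definition can_leave :: "('i, 'j) network \<Rightarrow> ('i, 'j) state \<Rightarrow> 'j \<Rightarrow> nat \<Rightarrow> bool" where
  "can_leave N C j l \<longleftrightarrow> 1 \<le> l \<and> l \<le> queue_length C j \<and>
     (case customer C j l of (i, s) \<Rightarrow> s = len N i)"

definition can_enter :: "('i, 'j) network \<Rightarrow> ('i, 'j) state \<Rightarrow> 'i \<Rightarrow> nat \<Rightarrow> bool" where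
  "can_enter N C i r \<longleftrightarrow> 1 \<le> r \<and> r \<le> queue_length C (route N i 1) + 1"


subsection \<open>Transition rates\<close>

text \<open>The rate from \<open>C\<close> to \<open>D\<close> adds up all ways to get from \<open>C\<close> to \<open>D\<close>; it is 0 if there is none.
  Theorems \<open>rate_move\<close>, \<open>rate_leave\<close> and \<open>rate_enter\<close> below give the rates of the three kinds of
  transitions separately: a state reached by one kind is not reached by another, and it determines
  the node from which, or the customer type by whose arrival, it is reached.\<close>

definition rate ::
  "('i::finite, 'j::finite) network \<Rightarrow> ('i, 'j) state \<Rightarrow> ('i, 'j) state \<Rightarrow> real" where
  "rate N C D =
     (\<Sum>j\<in>UNIV. \<Sum>(g, h) | can_move N C j g h \<and> move N C j g h = D.
        srv N j g * vel N j (queue_length C j) g * ins N (next_node N C j g) (dest_length N C j g) h) +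
     (\<Sum>j\<in>UNIV. \<Sum>g | can_leave N C j g \<and> leave C j g = D.
        srv N j g * vel N j (queue_length C j) g) +
     (\<Sum>i\<in>UNIV. \<Sum>h | can_enter N C i h \<and> enter N C i h = D.
        arr N i * ins N (route N i 1) (queue_length C (route N i 1) + 1) h)"

definition customers :: "('i, 'j::finite) state \<Rightarrow> ('i \<times> nat) multiset" where
  "customers C = (\<Sum>j\<in>UNIV. mset (C j))"

lemma customers_upd: "customers (C(j := xs)) + mset (C j) = customers C + mset xs"
proof -
  have "customers D = mset (D j) + (\<Sum>k\<in>UNIV - {j}. mset (D k))" for D :: "('a, 'b) state"
    unfolding customers_def by (simp add: sum.remove)
  from this[of C] this[of "C(j := xs)"] show ?thesis by simp
qed

lemma mset_insert_at: "mset (insert_at r x xs) = add_mset x (mset xs)"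
proof -
  have "mset (insert_at r x xs) = add_mset x (mset (take (r - 1) xs @ drop (r - 1) xs))"
    by (simp only: insert_at_def mset_append mset.simps) simp
  thus ?thesis by simp
qed

lemma mset_remove_at:
  assumes "1 \<le> l" "l \<le> length xs"
  shows "add_mset (xs ! (l - 1)) (mset (remove_at l xs)) = mset xs"
proof -
  from assms obtain m where m: "l = Suc m" "m < length xs" by (cases l) auto
  have "mset xs = mset (take m xs @ xs ! m # drop (Suc m) xs)"
    using m by (simp add: id_take_nth_drop[symmetric])
  with m show ?thesis by (simp add: remove_at_def)
qed

lemma customers_leave:
  assumes "1 \<le> l" "l \<le> queue_length C j"
  shows "add_mset (customer C j l) (customers (leave C j l)) = customers C"
proof -
  have "customers (leave C j l) + mset (C j) = customers C + mset (remove_at l (C j))"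
    unfolding leave_def by (rule customers_upd)
  moreover have "mset (C j) = add_mset (customer C j l) (mset (remove_at l (C j)))"
    using mset_remove_at[OF assms] by (simp add: customer_def)
  ultimately have "add_mset (customer C j l) (customers (leave C j l)) + mset (remove_at l (C j)) =
      customers C + mset (remove_at l (C j))" by simp
  thus ?thesis by (rule add_right_imp_eq)
qed

lemma customers_enter: "customers (enter N C i r) = add_mset (i, 1) (customers C)"
proof -
  define k where "k = route N i 1"
  have "customers (enter N C i r) + mset (C k) = customers C + mset (insert_at r (i, 1) (C k))"
    unfolding enter_def Let_def k_def by (rule customers_upd)
  thus ?thesis by (simp add: mset_insert_at)
qed

lemma customers_move:
  assumes "1 \<le> l" "l \<le> queue_length C j"
  shows "add_mset (customer C j l) (customers (move N C j l r)) =
         add_mset (fst (customer C j l), snd (customer C j l) + 1) (customers C)"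
proof -
  define k where "k = next_node N C j l"
  define x where "x = (fst (customer C j l), snd (customer C j l) + 1)"
  have mv: "move N C j l r = (leave C j l)(k := insert_at r x (leave C j l k))"
    by (simp add: move_def leave_def k_def x_def Let_def case_prod_beta)
  have "customers (move N C j l r) + mset (leave C j l k) =
        customers (leave C j l) + mset (insert_at r x (leave C j l k))"
    unfolding mv by (rule customers_upd)
  hence "customers (move N C j l r) = add_mset x (customers (leave C j l))"
    by (simp add: mset_insert_at)
  thus ?thesis using customers_leave[where C=C and j=j, OF assms]
    by (metis add_mset_commute x_def)
qed

lemma size_customers_move: "can_move N C j l r \<Longrightarrow> size (customers (move N C j l r)) = size (customers C)"
  using arg_cong[OF customers_move, of l C j size N r] by (simp add: can_move_def)

lemma size_customers_leave: "can_leave N C j l \<Longrightarrow> Suc (size (customers (leave C j l))) = size (customers C)"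
  using arg_cong[OF customers_leave, of l C j size] by (simp add: can_leave_def)

lemma size_customers_enter: "size (customers (enter N C i r)) = Suc (size (customers C))"
  by (simp add: customers_enter)

lemma customer_node:
  assumes "C \<in> states N" "1 \<le> l" "l \<le> queue_length C j" "customer C j l = (i, s)"
  shows "route N i s = j"
proof -
  have "(i, s) \<in> set (C j)" using assms nth_mem[of "l - 1" "C j"] by (simp add: customer_def)
  thus ?thesis using assms(1) by (auto simp: states_def)
qed

lemma move_eq_node:
  fixes C :: "('i, 'j::finite) state"
  assumes "C \<in> states N" "can_move N C j l r" "can_move N C k g h" "move N C k g h = move N C j l r"
  shows "k = j"
proof -
  obtain i s where x: "customer C j l = (i, s)" by fastforce
  obtain i' s' where y: "customer C k g = (i', s')" by fastforce
  have l: "1 \<le> l" "l \<le> queue_length C j" and g: "1 \<le> g" "g \<le> queue_length C k"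
    using assms by (auto simp: can_move_def)
  let ?D = "customers (move N C j l r)"
  have 1: "add_mset (i, s) ?D = add_mset (i, s + 1) (customers C)"
    using customers_move[where C=C and j=j, OF l, of N r] by (simp add: x)
  have 2: "add_mset (i', s') ?D = add_mset (i', s' + 1) (customers C)"
    using customers_move[where C=C and j=k, OF g, of N h] by (simp add: y assms(4))
  have "add_mset (i', s' + 1) (add_mset (i, s) ?D) = add_mset (i, s + 1) (add_mset (i', s') ?D)"
    unfolding 1 2 by (rule add_mset_commute)
  hence "{#(i', s' + 1), (i, s)#} + ?D = {#(i, s + 1), (i', s')#} + ?D" by simp
  hence "{#(i', s' + 1), (i, s)#} = {#(i, s + 1), (i', s')#}" by (rule add_right_imp_eq)
  hence "(i', s') \<in># {#(i', s' + 1), (i, s)#}" by (metis union_single_eq_member add_mset_commute)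
  hence "(i', s') = (i, s)" by simp
  thus ?thesis using customer_node[OF assms(1) l x] customer_node[OF assms(1) g y] by simp
qed

lemma leave_eq_node:
  fixes C :: "('i, 'j::finite) state"
  assumes "C \<in> states N" "can_leave N C j l" "can_leave N C k g" "leave C k g = leave C j l"
  shows "k = j"
proof -
  obtain i s where x: "customer C j l = (i, s)" by fastforce
  obtain i' s' where y: "customer C k g = (i', s')" by fastforce
  have l: "1 \<le> l" "l \<le> queue_length C j" and g: "1 \<le> g" "g \<le> queue_length C k"
    using assms by (auto simp: can_leave_def)
  have "add_mset (i', s') (customers (leave C j l)) = add_mset (i, s) (customers (leave C j l))"
    using customers_leave[where C=C and j=j, OF l] customers_leave[where C=C and j=k, OF g]
    by (simp add: x y assms(4))
  hence "(i', s') = (i, s)" by simp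
  thus ?thesis using customer_node[OF assms(1) l x] customer_node[OF assms(1) g y] by simp
qed

lemma enter_eq_type:
  fixes C :: "('i, 'j::finite) state"
  shows "enter N C i' h = enter N C i r \<Longrightarrow> i' = i"
  using customers_enter[of N C i' h] customers_enter[of N C i r] by simp

lemma sum_single_UNIV:
  fixes a :: "'b::finite \<Rightarrow> real"
  assumes "\<And>k. k \<noteq> j \<Longrightarrow> a k = 0" "a j = c"
  shows "(\<Sum>k\<in>UNIV. a k) = c"
  using assms by (subst sum.remove[of UNIV j]) (auto intro!: sum.neutral)

theorem rate_move:
  assumes "C \<in> states N" "can_move N C j l r"
  shows "rate N C (move N C j l r) =
    (\<Sum>(g, h) | can_move N C j g h \<and> move N C j g h = move N C j l r.
       srv N j g * vel N j (queue_length C j) g *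
       (let k = next_node N C j g in
        if k \<noteq> j then ins N k (queue_length C k + 1) h else ins N j (queue_length C j) h))"
proof -
  let ?D = "move N C j l r"
  have A: "{(g, h). can_move N C k g h \<and> move N C k g h = ?D} = {}" if "k \<noteq> j" for k
    using move_eq_node[OF assms] that by blast
  have B: "{g. can_leave N C k g \<and> leave C k g = ?D} = {}" for k
  proof -
    have "size (customers (leave C k g)) \<noteq> size (customers ?D)" if "can_leave N C k g" for g
      using size_customers_leave[OF that] size_customers_move[OF assms(2)] by linarith
    thus ?thesis by fastforce
  qed
  have E: "{h. can_enter N C i h \<and> enter N C i h = ?D} = {}" for i
  proof -
    have "size (customers (enter N C i h)) \<noteq> size (customers ?D)" for h
      using size_customers_enter[of N C i h] size_customers_move[OF assms(2)] by linarith
    hence "enter N C i h \<noteq> ?D" for h by metis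
    thus ?thesis by simp
  qed
  have ins: "ins N (next_node N C j g) (dest_length N C j g) h =
      (let k = next_node N C j g in
       if k \<noteq> j then ins N k (queue_length C k + 1) h else ins N j (queue_length C j) h)" for g h
    by (simp add: dest_length_def Let_def)
  show ?thesis
    unfolding rate_def B E sum.empty sum.neutral_const add_0_right
    by (rule sum_single_UNIV[of j], subst A, assumption, rule sum.empty, unfold ins, rule refl)
qed

theorem rate_leave:
  assumes "C \<in> states N" "can_leave N C j l"
  shows "rate N C (leave C j l) =
    (\<Sum>g | can_leave N C j g \<and> leave C j g = leave C j l. srv N j g * vel N j (queue_length C j) g)"
proof -
  let ?D = "leave C j l"
  have A: "{(g, h). can_move N C k g h \<and> move N C k g h = ?D} = {}" for k
  proof -
    have "size (customers (move N C k g h)) \<noteq> size (customers ?D)" if "can_move N C k g h" for g h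
      using size_customers_move[OF that] size_customers_leave[OF assms(2)] by linarith
    thus ?thesis by fastforce
  qed
  have B: "{g. can_leave N C k g \<and> leave C k g = ?D} = {}" if "k \<noteq> j" for k
    using leave_eq_node[OF assms] that by blast
  have E: "{h. can_enter N C i h \<and> enter N C i h = ?D} = {}" for i
  proof -
    have "size (customers (enter N C i h)) \<noteq> size (customers ?D)" for h
      using size_customers_enter[of N C i h] size_customers_leave[OF assms(2)] by linarith
    hence "enter N C i h \<noteq> ?D" for h by metis
    thus ?thesis by simp
  qed
  show ?thesis
    unfolding rate_def A E sum.empty sum.neutral_const add_0_right add_0_left
    by (rule sum_single_UNIV[of j], subst B, assumption, rule sum.empty, rule refl)
qed

theorem rate_enter:
  assumes "can_enter N C i r"
  shows "rate N C (enter N C i r) =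
    (\<Sum>h | can_enter N C i h \<and> enter N C i h = enter N C i r.
       arr N i * ins N (route N i 1) (queue_length C (route N i 1) + 1) h)"
proof -
  let ?D = "enter N C i r"
  have A: "{(g, h). can_move N C k g h \<and> move N C k g h = ?D} = {}" for k
  proof -
    have "size (customers (move N C k g h)) \<noteq> size (customers ?D)" if "can_move N C k g h" for g h
      using size_customers_move[OF that] size_customers_enter[of N C i r] by linarith
    thus ?thesis by fastforce
  qed
  have B: "{g. can_leave N C k g \<and> leave C k g = ?D} = {}" for k
  proof -
    have "size (customers (leave C k g)) \<noteq> size (customers ?D)" if "can_leave N C k g" for g
      using size_customers_leave[OF that] size_customers_enter[of N C i r] by linarith
    thus ?thesis by fastforce
  qed
  have E: "{h. can_enter N C k h \<and> enter N C k h = ?D} = {}" if "k \<noteq> i" for k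
  proof -
    have "enter N C k h \<noteq> ?D" for h
      using enter_eq_type[of N C k h i r] that by (rule contrapos_nn[rotated])
    thus ?thesis by simp
  qed
  show ?thesis
    unfolding rate_def A B sum.empty sum.neutral_const add_0_left
    by (rule sum_single_UNIV[of i], subst E, assumption, rule sum.empty, rule refl)
qed


subsection \<open>The quantities in the equilibrium distribution\<close>

definition alpha :: "('i, 'j) network \<Rightarrow> 'j \<Rightarrow> 'i \<Rightarrow> nat \<Rightarrow> real" where
  "alpha N j i s = (if route N i s = j then arr N i else 0)"

definition load :: "('i::finite, 'j) network \<Rightarrow> 'j \<Rightarrow> real" where
  "load N j = (\<Sum>i\<in>UNIV. \<Sum>s=1..len N i. alpha N j i s)"

definition norm_const :: "('i::finite, 'j) network \<Rightarrow> 'j \<Rightarrow> real" where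
  "norm_const N j = inverse (\<Sum>n. load N j ^ n / (\<Prod>l=1..n. srv N j l))"

end

theory Submission
  imports Defs
begin

text \<open>
  The equilibrium distribution is a product: independently for each node \<open>j\<close>, the queue length \<open>n\<close> has
  probability \<open>B\<^sub>j b\<^sub>j\<^sup>n / (\<mu>\<^sub>j(1) \<dots> \<mu>\<^sub>j(n))\<close>, and given the queue lengths the customers in all positions
  are independent, with type and stage \<open>(i, s)\<close> having probability \<open>\<alpha>\<^sub>j(i, s) / b\<^sub>j\<close>. The
  powers of \<open>b\<^sub>j\<close> cancel, so a state has probability proportional to the product over its customers of
  the arrival rate of their type, divided by \<open>\<mu>\<^sub>j(1) \<dots> \<mu>\<^sub>j(n\<^sub>j)\<close> for each node. All claims can be
  read off this description, so the task is to show that it is the law of \<open>X t\<close>. There are two halves.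

  The product form satisfies the balance equations (\<open>equilibrium_balance\<close>). With one customer of type
  \<open>i\<close> singled out and the state \<open>D\<close> of the others held fixed, this customer enters the weight of the whole
  state only through the factor \<open>v(i) / \<mu>\<^sub>k(n)\<close>, where \<open>k\<close> is its node and \<open>n\<close> the queue length there.
  As the service rates of all positions sum to \<open>\<mu>\<^sub>k(n)\<close>, the customer leaves each stage of
  its path with total flow \<open>v(i)\<close> times the weight of \<open>D\<close>, the flow with which it
  entered the network. So for each stage the flow into it matches the flow out of it.

  The law of a stationary process with these rates is determined by them (\<open>stationary_law\<close>). Stationarity
  and the definition of the rates as derivatives at 0 give at once that the inflow into each state is at
  most the outflow (\<open>stationary_subinvariant\<close>). Here each jump changes the number of customers by at most
  one, there are finitely many states with a given number of customers, and the rate of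
  arrivals is constant. Summing over the states with at most \<open>n\<close> customers, the total deficit is at most
  the arrival rate times the probability of exactly \<open>n\<close> customers, which tends to 0; so the balance
  equations hold exactly (\<open>subinvariant_imp_invariant\<close>). The balance equations have only one
  normalised solution because the empty state can be reached from everywhere (\<open>invariant_pmf_unique\<close>,
  \<open>work_decreases\<close>).
\<close>


section \<open>Subinvariant distributions of skip-free jump processes\<close>

text \<open>A jump process graded by a level with finite level sets, whose jumps change the level by at most
  one and whose total upward rate is bounded. For the network the level is the number of customers,
  and the upward rate is the total arrival rate.\<close>

locale skip_free_rates =
  fixes S :: "'s set" and lev :: "'s \<Rightarrow> nat" and q :: "'s \<Rightarrow> 's \<Rightarrow> real" and up :: real
  assumes finite_levels: "finite {x \<in> S. lev x \<le> n}"
    and rate_nonneg: "0 \<le> q x y"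
    and skip_free: "q x y \<noteq> 0 \<Longrightarrow> lev x \<le> Suc (lev y) \<and> lev y \<le> Suc (lev x)"
    and up_bounded: "y \<in> S \<Longrightarrow> (\<Sum>z | z \<in> S \<and> lev z = Suc (lev y). q y z) \<le> up"
begin

definition below :: "nat \<Rightarrow> 's set" where
  "below n = {x \<in> S. lev x \<le> n}"

text \<open>Since jumps change the level by at most one, the finite sums below contain every nonzero term of the sums
  over all states. Both include the diagonal term \<open>q y y\<close>, so that \<open>inflow v y = v y * outrate y\<close> is
  the balance equation at \<open>y\<close> whatever the diagonal values are.\<close>

definition inflow :: "('s \<Rightarrow> real) \<Rightarrow> 's \<Rightarrow> real" where
  "inflow v y = (\<Sum>x\<in>below (Suc (lev y)). v x * q x y)"

definition outrate :: "'s \<Rightarrow> real" where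
  "outrate y = (\<Sum>z\<in>below (Suc (lev y)). q y z)"

lemma finite_below [simp]: "finite (below n)"
  using finite_levels by (simp add: below_def)

lemma below_mono: "m \<le> n \<Longrightarrow> below m \<subseteq> below n"
  by (auto simp: below_def)

lemma inflow_extend: "lev y < n \<Longrightarrow> inflow v y = (\<Sum>x\<in>below n. v x * q x y)"
  unfolding inflow_def
  by (rule sum.mono_neutral_left) (use skip_free finite_levels in \<open>auto simp: below_def\<close>)

lemma outrate_extend: "lev y < n \<Longrightarrow> outrate y = (\<Sum>z\<in>below n. q y z)"
  unfolding outrate_def
  by (rule sum.mono_neutral_left) (use skip_free finite_levels in \<open>auto simp: below_def\<close>)

text \<open>Summing the balance deficits over all states of level at most \<open>n\<close>, the flow inside this set cancels;
  what is left is the flow across the cut, upwards minus downwards, and the upward part leaves from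
  level \<open>n\<close> only.\<close>

lemma cut_deficit:
  assumes v: "\<And>x. 0 \<le> v x"
  shows "(\<Sum>y\<in>below n. v y * outrate y - inflow v y) \<le> up * (\<Sum>y | y \<in> S \<and> lev y = n. v y)"
proof -
  let ?T = "below (Suc n)" and ?B = "below n"
  have sub: "?B \<subseteq> ?T" by (rule below_mono) simp
  have layer: "?T - ?B = {z \<in> S. lev z = Suc n}" by (auto simp: below_def)
  have fin_n: "finite {y \<in> S. lev y = n}"
    by (rule finite_subset[OF _ finite_below[of n]]) (auto simp: below_def)
  have "(\<Sum>y\<in>?B. v y * outrate y) = (\<Sum>y\<in>?B. \<Sum>z\<in>?T. v y * q y z)"
    by (intro sum.cong refl, subst outrate_extend[of _ "Suc n"]) (auto simp: below_def sum_distrib_left)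
  also have "\<dots> = (\<Sum>y\<in>?B. (\<Sum>z\<in>?B. v y * q y z) + (\<Sum>z\<in>?T - ?B. v y * q y z))"
    by (intro sum.cong refl) (simp add: sum.subset_diff[OF sub] add.commute)
  finally have out: "(\<Sum>y\<in>?B. v y * outrate y) =
      (\<Sum>y\<in>?B. \<Sum>z\<in>?B. v y * q y z) + (\<Sum>y\<in>?B. v y * (\<Sum>z\<in>?T - ?B. q y z))"
    by (simp add: sum.distrib sum_distrib_left)
  have "(\<Sum>y\<in>?B. inflow v y) = (\<Sum>y\<in>?B. \<Sum>x\<in>?T. v x * q x y)"
    by (intro sum.cong refl inflow_extend) (auto simp: below_def)
  also have "\<dots> \<ge> (\<Sum>y\<in>?B. \<Sum>x\<in>?B. v x * q x y)"
    by (intro sum_mono sum_mono2) (use sub v rate_nonneg in auto)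
  also have "(\<Sum>y\<in>?B. \<Sum>x\<in>?B. v x * q x y) = (\<Sum>y\<in>?B. \<Sum>z\<in>?B. v y * q y z)"
    by (rule sum.swap)
  finally have "(\<Sum>y\<in>?B. v y * outrate y - inflow v y) \<le> (\<Sum>y\<in>?B. v y * (\<Sum>z\<in>?T - ?B. q y z))"
    using out by (simp add: sum_subtractf)
  also have "\<dots> = (\<Sum>y | y \<in> S \<and> lev y = n. v y * (\<Sum>z\<in>?T - ?B. q y z))"
  proof (rule sum.mono_neutral_right)
    show "\<forall>y\<in>?B - {y. y \<in> S \<and> lev y = n}. v y * (\<Sum>z\<in>?T - ?B. q y z) = 0"
    proof
      fix y assume "y \<in> ?B - {y. y \<in> S \<and> lev y = n}"
      hence "lev y < n" by (auto simp: below_def)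
      hence "(\<Sum>z\<in>?T - ?B. q y z) = 0"
        unfolding layer by (intro sum.neutral) (use skip_free in fastforce)
      thus "v y * (\<Sum>z\<in>?T - ?B. q y z) = 0" by simp
    qed
  qed (auto simp: below_def finite_levels)
  also have "\<dots> \<le> (\<Sum>y | y \<in> S \<and> lev y = n. v y * up)"
    unfolding layer by (intro sum_mono mult_left_mono) (use v up_bounded in auto)
  also have "\<dots> = up * (\<Sum>y | y \<in> S \<and> lev y = n. v y)"
    by (simp add: sum_distrib_left mult.commute)
  finally show ?thesis .
qed

text \<open>The deficits are nonnegative, so each of them is at most the upward flow across every cut above its
  state. That flow is bounded by a multiple of the mass of one level, which tends to 0 because \<open>v\<close> is
  summable.\<close>

lemma subinvariant_imp_invariant:
  assumes v: "\<And>x. 0 \<le> v x" and bound: "\<And>F. finite F \<Longrightarrow> F \<subseteq> S \<Longrightarrow> sum v F \<le> K"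
    and sub: "\<And>y. y \<in> S \<Longrightarrow> inflow v y \<le> v y * outrate y" and y: "y \<in> S"
  shows "inflow v y = v y * outrate y"
proof -
  let ?d = "\<lambda>y. v y * outrate y - inflow v y"
  let ?w = "\<lambda>n. \<Sum>y | y \<in> S \<and> lev y = n. v y"
  have fin: "finite {y \<in> S. lev y = n}" for n
    by (rule finite_subset[OF _ finite_below[of n]]) (auto simp: below_def)
  have "(\<Sum>n<m. ?w n) \<le> K" for m
  proof -
    have "(\<Sum>n<m. ?w n) = sum v (\<Union>n\<in>{..<m}. {y \<in> S. lev y = n})"
      using fin by (subst sum.UNION_disjoint) auto
    also have "\<dots> \<le> K" by (rule bound) (use fin in auto)
    finally show ?thesis .
  qed
  hence "summable ?w" by (intro summableI_nonneg_bounded) (auto intro: sum_nonneg v)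
  hence "?w \<longlonglongrightarrow> 0" by (rule summable_LIMSEQ_zero)
  hence lim: "(\<lambda>n. up * ?w n) \<longlonglongrightarrow> up * 0" by (rule tendsto_mult_left)
  have "\<forall>\<^sub>F n in sequentially. ?d y \<le> up * ?w n"
  proof (rule eventually_sequentiallyI)
    fix n assume n: "lev y \<le> n"
    have "?d y \<le> (\<Sum>y\<in>below n. ?d y)"
      by (rule member_le_sum) (use n y sub in \<open>auto simp: below_def finite_levels\<close>)
    also have "\<dots> \<le> up * ?w n" by (rule cut_deficit[OF v])
    finally show "?d y \<le> up * ?w n" .
  qed
  hence "?d y \<le> up * 0" by (intro tendsto_lowerbound[OF lim]) auto
  with sub[OF y] show ?thesis by simp
qed

text \<open>If an invariant \<open>v \<ge> 0\<close> vanishes at \<open>y\<close>, then nothing flows into \<open>y\<close>, so \<open>v\<close> vanishes at every state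
  from which \<open>y\<close> is reached in one jump. The assumption on \<open>W\<close> provides a path to \<open>e\<close> from each state.\<close>

lemma invariant_eq_0:
  fixes W :: "'s \<Rightarrow> nat"
  assumes v: "\<And>x. 0 \<le> v x" and inv: "\<And>y. y \<in> S \<Longrightarrow> inflow v y = v y * outrate y"
    and e: "v e = 0"
    and descend: "\<And>x. x \<in> S \<Longrightarrow> x \<noteq> e \<Longrightarrow> \<exists>y\<in>S. W y < W x \<and> 0 < q x y"
    and x: "x \<in> S"
  shows "v x = 0"
  using x
proof (induction "W x" arbitrary: x rule: less_induct)
  case less
  show ?case
  proof (cases "x = e")
    case False
    then obtain y where y: "y \<in> S" "W y < W x" "0 < q x y" using descend less.prems by blast
    have "v x * q x y \<le> inflow v y"
      unfolding inflow_def
      by (rule member_le_sum) (use y less.prems skip_free[of x y] v rate_nonneg in \<open>auto simp: below_def finite_levels\<close>)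
    also have "\<dots> = 0" using inv[OF y(1)] less.hyps[OF y(2,1)] by simp
    finally show ?thesis using y(3) v[of x] by (simp add: mult_le_0_iff)
  qed (simp add: e)
qed

text \<open>The pointwise minimum \<open>m\<close> of the two distributions is again subinvariant, because inflow is monotone,
  hence invariant. So both excesses over \<open>m\<close> are invariant. At \<open>e\<close> one of them vanishes, and that one
  then vanishes everywhere; but two different distributions each exceed the other somewhere.\<close>

theorem invariant_pmf_unique:
  fixes p p' :: "'s pmf" and W :: "'s \<Rightarrow> nat"
  assumes p: "set_pmf p \<subseteq> S" "\<And>y. y \<in> S \<Longrightarrow> inflow (pmf p) y \<le> pmf p y * outrate y"
    and p': "set_pmf p' \<subseteq> S" "\<And>y. y \<in> S \<Longrightarrow> inflow (pmf p') y \<le> pmf p' y * outrate y"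
    and descend: "\<And>x. x \<in> S \<Longrightarrow> x \<noteq> e \<Longrightarrow> \<exists>y\<in>S. W y < W x \<and> 0 < q x y"
  shows "p = p'"
proof (rule ccontr)
  assume neq: "p \<noteq> p'"
  define m where "m x = min (pmf p x) (pmf p' x)" for x
  have nonneg_out: "0 \<le> outrate y" for y
    unfolding outrate_def by (intro sum_nonneg rate_nonneg)
  have mono: "inflow u y \<le> inflow w y" if "\<And>x. u x \<le> w x" for u w y
    unfolding inflow_def by (intro sum_mono mult_right_mono that rate_nonneg)
  have bound: "sum (pmf r) F \<le> 1" if "finite F" for r :: "'s pmf" and F
    using that by (metis measure_measure_pmf_finite measure_pmf.prob_le_1)
  have inv: "inflow (pmf r) y = pmf r y * outrate y"
    if "\<And>y. y \<in> S \<Longrightarrow> inflow (pmf r) y \<le> pmf r y * outrate y" "y \<in> S" for r y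
    by (rule subinvariant_imp_invariant[where K = 1]) (use that bound in auto)
  have inv_m: "inflow m y = m y * outrate y" if "y \<in> S" for y
  proof (rule subinvariant_imp_invariant[where K = 1])
    fix y assume y: "y \<in> S"
    have "inflow m y \<le> inflow (pmf p) y" "inflow m y \<le> inflow (pmf p') y"
      by (auto intro!: mono simp: m_def)
    with p(2)[OF y] p'(2)[OF y] show "inflow m y \<le> m y * outrate y"
      by (auto simp: m_def min_def)
  next
    fix F :: "'s set" assume "finite F"
    have "sum m F \<le> sum (pmf p) F" by (intro sum_mono) (simp add: m_def)
    with bound[OF \<open>finite F\<close>, of p] show "sum m F \<le> 1" by simp
  qed (use that in \<open>auto simp: m_def\<close>)
  have exceed: "m e < pmf r e" if r: "set_pmf r \<subseteq> S" "\<And>y. y \<in> S \<Longrightarrow> inflow (pmf r) y \<le> pmf r y * outrate y"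
      "\<And>x. m x \<le> pmf r x" "m x < pmf r x" for r x
  proof (rule ccontr)
    assume "\<not> m e < pmf r e"
    with r(3)[of e] have e: "pmf r e - m e = 0" by simp
    have "0 \<le> m x" by (simp add: m_def)
    with r(4) have "x \<in> set_pmf r" by (simp add: set_pmf_iff)
    with r(1) have x: "x \<in> S" by blast
    have "pmf r x - m x = 0"
    proof (rule invariant_eq_0[where v = "\<lambda>x. pmf r x - m x" and W = W and e = e])
      fix y assume y: "y \<in> S"
      show "inflow (\<lambda>x. pmf r x - m x) y = (pmf r y - m y) * outrate y"
        using inv[OF r(2) y] inv_m[OF y]
        by (simp add: inflow_def left_diff_distrib sum_subtractf)
    next
      show "pmf r e - m e = 0" by (rule e)
      show "0 \<le> pmf r x - m x" for x using r(3)[of x] by simp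
    qed (fact descend x)+
    with r(4) show False by simp
  qed
  obtain x where "pmf p x < pmf p' x" using pmf_neq_exists_less[OF neq] by blast
  hence "m e < pmf p' e" by (intro exceed[of _ x] p') (auto simp: m_def)
  moreover obtain x where "pmf p' x < pmf p x" using pmf_neq_exists_less[OF neq[symmetric]] by blast
  hence "m e < pmf p e" by (intro exceed[of _ x] p) (auto simp: m_def)
  ultimately show False by (simp add: m_def)
qed

end

section \<open>Subinvariance of the law of a stationary Markov process\<close>

text \<open>The only link between the continuous-time process and its rates. For \<open>h > 0\<close>, being in a state of
  \<open>insert y F\<close> at time 0 and in \<open>y\<close> at time \<open>h\<close> has probability at most that of being in \<open>y\<close> at time
  \<open>h\<close>, which is \<open>p y\<close> by stationarity. Subtracting the value at \<open>h = 0\<close>, dividing by \<open>h\<close> and letting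
  \<open>h\<close> tend to 0 gives the claim. Only finitely many starting states are kept, so that the limit may be taken
  term by term; this is why an inequality results.\<close>

lemma stationary_subinvariant:
  assumes X: "markov_process M S q X" and st: "stationary_process M X"
    and F: "finite F" "F \<subseteq> S - {y}" and y: "y \<in> S"
  defines "p \<equiv> \<lambda>x. \<P>(\<omega> in M. X 0 \<omega> = x)"
  shows "(\<Sum>x\<in>F. p x * q x y) \<le> p y * infsum (q y) (S - {y})"
proof -
  interpret prob_space M using X by (simp add: markov_process_def)
  obtain P where P: "transition_function S P" "has_rates S P q"
    and joint: "\<And>m (u :: nat \<Rightarrow> real) x. 0 \<le> u 0 \<Longrightarrow> (\<forall>k\<le>m. u k < u (Suc k)) \<Longrightarrow> (\<forall>k\<le>Suc m. x k \<in> S) \<Longrightarrow>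
           \<P>(\<omega> in M. \<forall>k\<le>Suc m. X (u k) \<omega> = x k) =
           \<P>(\<omega> in M. \<forall>k\<le>m. X (u k) \<omega> = x k) * P (u (Suc m) - u m) (x m) (x (Suc m))"
    using X unfolding markov_process_def by (elim conjE exE) blast
  have meas: "X t \<in> measurable M (count_space S)" if "t \<ge> 0" for t
    using X that by (simp add: markov_process_def)
  have ev: "{\<omega> \<in> space M. X t \<omega> = x} \<in> events" if "t \<ge> 0" "x \<in> S" for t x
  proof -
    have "X t -` {x} \<inter> space M \<in> events" using measurable_sets[OF meas[OF that(1)], of "{x}"] that(2) by simp
    moreover have "X t -` {x} \<inter> space M = {\<omega> \<in> space M. X t \<omega> = x}" by auto
    ultimately show ?thesis by simp
  qed
  have two: "\<P>(\<omega> in M. X 0 \<omega> = x \<and> X h \<omega> = y) = p x * P h x y" if "h > 0" "x \<in> S" for h x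
  proof -
    have a: "(\<forall>k\<le>Suc 0. Q k) \<longleftrightarrow> Q 0 \<and> Q 1" for Q :: "nat \<Rightarrow> bool"
      by (auto simp: le_Suc_eq)
    show ?thesis
      using joint[of "\<lambda>k. real k * h" 0 "\<lambda>k. if k = 0 then x else y"] that y
      by (simp add: a p_def)
  qed
  have le: "(\<Sum>x\<in>insert y F. p x * P h x y) \<le> p y" if h: "h > 0" for h
  proof -
    have "(\<Sum>x\<in>insert y F. p x * P h x y) = (\<Sum>x\<in>insert y F. prob {\<omega> \<in> space M. X 0 \<omega> = x \<and> X h \<omega> = y})"
      by (rule sum.cong) (use two[OF h] F y in auto)
    also have "\<dots> = prob (\<Union>x\<in>insert y F. {\<omega> \<in> space M. X 0 \<omega> = x \<and> X h \<omega> = y})"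
    proof (rule finite_measure_finite_Union[symmetric])
      show "(\<lambda>x. {\<omega> \<in> space M. X 0 \<omega> = x \<and> X h \<omega> = y}) ` insert y F \<subseteq> events"
        using F y h by (auto intro!: sets.sets_Collect_conj ev)
    qed (use F in \<open>auto simp: disjoint_family_on_def\<close>)
    also have "\<dots> \<le> prob {\<omega> \<in> space M. X h \<omega> = y}"
      by (rule finite_measure_mono) (use ev[of h y] h y in auto)
    also have "\<dots> = p y"
      using st[unfolded stationary_process_def, rule_format, of "{0}" h "\<lambda>_. y"] h by (simp add: p_def)
    finally show ?thesis .
  qed
  have P0: "P 0 x y = of_bool (x = y)" if "x \<in> S" for x
    using P(1) that y by (simp add: transition_function_def)
  let ?q = "\<lambda>x. if x = y then - infsum (q x) (S - {x}) else q x y"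
  have diff_quotient: "((\<lambda>h. (P h x y - P 0 x y) / h) \<longlongrightarrow> ?q x) (at_right 0)" if "x \<in> S" for x
    using P(2) y that unfolding has_rates_def by blast
  have "((\<lambda>h. \<Sum>x\<in>insert y F. p x * ((P h x y - P 0 x y) / h)) \<longlongrightarrow> (\<Sum>x\<in>insert y F. p x * ?q x)) (at_right 0)"
    by (intro tendsto_sum tendsto_mult_left) (use F y in \<open>blast intro: diff_quotient\<close>)
  moreover have "\<forall>\<^sub>F h in at_right 0. (\<Sum>x\<in>insert y F. p x * ((P h x y - P 0 x y) / h)) \<le> 0"
  proof (rule eventually_at_right_less[THEN eventually_mono])
    fix h :: real assume h: "0 < h"
    have "(\<Sum>x\<in>insert y F. p x * P 0 x y) = (\<Sum>x\<in>insert y F. if x = y then p y else 0)"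
      by (rule sum.cong) (use F y P0 in auto)
    also have "\<dots> = p y" using F by simp
    finally have "(\<Sum>x\<in>insert y F. p x * (P h x y - P 0 x y)) \<le> 0"
      using le[OF h] by (simp add: right_diff_distrib sum_subtractf)
    hence "(\<Sum>x\<in>insert y F. p x * (P h x y - P 0 x y)) / h \<le> 0"
      using h by (simp add: divide_nonpos_pos)
    thus "(\<Sum>x\<in>insert y F. p x * ((P h x y - P 0 x y) / h)) \<le> 0"
      by (simp add: sum_divide_distrib)
  qed
  ultimately have "(\<Sum>x\<in>insert y F. p x * ?q x) \<le> 0"
    by (rule tendsto_upperbound) simp
  moreover have "(\<Sum>x\<in>insert y F. p x * ?q x) = (\<Sum>x\<in>F. p x * q x y) - p y * infsum (q y) (S - {y})"
  proof -
    have "y \<notin> F" using F by auto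
    moreover from this have "(\<Sum>x\<in>F. p x * ?q x) = (\<Sum>x\<in>F. p x * q x y)"
      by (intro sum.cong) auto
    ultimately show ?thesis using F(1) by simp
  qed
  ultimately show ?thesis by simp
qed

section \<open>Transitions of the network as removal and insertion of a customer\<close>

text \<open>The state after a customer of type \<open>i\<close>, about to begin stage \<open>s\<close>, joins \<open>D\<close> in position \<open>h\<close>. Every
  transition consists of taking a customer out of a position and putting it, or a new one, into another:
  with \<open>D\<close> the state without that customer, a movement leads from \<open>put N D i s g\<close> to
  \<open>put N D i (s + 1) h\<close>, which treats departure and arrival, feedback included, symmetrically.\<close>

definition put :: "('i, 'j) network \<Rightarrow> ('i, 'j) state \<Rightarrow> 'i \<Rightarrow> nat \<Rightarrow> nat \<Rightarrow> ('i, 'j) state" where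
  "put N D i s h = D(route N i s := insert_at h (i, s) (D (route N i s)))"

text \<open>Probability that \<open>y\<close> results when a customer of type \<open>i\<close> is sent to stage \<open>s\<close> of its path while the
  others are in state \<open>D\<close>; stage \<open>len N i + 1\<close> stands for the outside, so that departures need no
  separate treatment.\<close>

definition arrival_prob :: "('i, 'j) network \<Rightarrow> ('i, 'j) state \<Rightarrow> 'i \<Rightarrow> nat \<Rightarrow> ('i, 'j) state \<Rightarrow> real" where
  "arrival_prob N D i s y =
     (if s \<le> len N i
      then (\<Sum>h=1..queue_length D (route N i s) + 1.
              ins N (route N i s) (queue_length D (route N i s) + 1) h * of_bool (put N D i s h = y))
      else of_bool (D = y))"

abbreviation population :: "('i, 'j::finite) state \<Rightarrow> nat" where
  "population C \<equiv> size (customers C)"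

definition states_upto :: "('i, 'j::finite) network \<Rightarrow> nat \<Rightarrow> ('i, 'j) state set" where
  "states_upto N n = {C \<in> states N. population C \<le> n}"

lemma length_insert_at: "1 \<le> r \<Longrightarrow> r \<le> length xs + 1 \<Longrightarrow> length (insert_at r x xs) = length xs + 1"
  by (auto simp: insert_at_def)

lemma length_remove_at: "1 \<le> l \<Longrightarrow> l \<le> length xs \<Longrightarrow> Suc (length (remove_at l xs)) = length xs"
  by (auto simp: remove_at_def)

lemma nth_insert_at: "1 \<le> r \<Longrightarrow> r \<le> length xs + 1 \<Longrightarrow> insert_at r x xs ! (r - 1) = x"
  by (auto simp: insert_at_def nth_append)

lemma remove_insert_at: "1 \<le> r \<Longrightarrow> r \<le> length xs + 1 \<Longrightarrow> remove_at r (insert_at r x xs) = xs"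
  by (cases r) (auto simp: insert_at_def remove_at_def min_def)

lemma insert_remove_at: "1 \<le> l \<Longrightarrow> l \<le> length xs \<Longrightarrow> insert_at l (xs ! (l - 1)) (remove_at l xs) = xs"
  by (cases l) (auto simp: insert_at_def remove_at_def min_def id_take_nth_drop[symmetric])

lemma move_eq_put: "customer C j l = (i, s) \<Longrightarrow> move N C j l h = put N (leave C j l) i (s + 1) h"
  by (simp add: move_def put_def leave_def next_node_def Let_def)

lemma enter_eq_put: "enter N C i h = put N C i 1 h"
  by (simp add: enter_def put_def Let_def)

lemma leave_put:
  assumes "1 \<le> g" "g \<le> queue_length D (route N i s) + 1"
  shows "leave (put N D i s g) (route N i s) g = D"
  using assms by (simp add: leave_def put_def remove_insert_at)

lemma customer_put:
  assumes "1 \<le> g" "g \<le> queue_length D (route N i s) + 1"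
  shows "customer (put N D i s g) (route N i s) g = (i, s)"
  using assms nth_insert_at[OF assms] by (simp add: customer_def put_def)

lemma put_leave:
  assumes "1 \<le> g" "g \<le> queue_length C j" "customer C j g = (i, s)" "route N i s = j"
  shows "put N (leave C j g) i s g = C"
  using assms insert_remove_at[of g "C j"] by (simp add: put_def leave_def customer_def)

lemma queue_length_put:
  assumes "1 \<le> g" "g \<le> queue_length D (route N i s) + 1"
  shows "queue_length (put N D i s g) (route N i s) = queue_length D (route N i s) + 1"
  using assms by (simp add: put_def length_insert_at)

lemma set_insert_at: "set (insert_at h x xs) = insert x (set xs)"
  using arg_cong[OF mset_insert_at[of h x xs], of set_mset] by simp

lemma put_in_states:
  assumes "D \<in> states N" "1 \<le> s" "s \<le> len N i"
  shows "put N D i s h \<in> states N"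
  using assms by (auto simp: states_def put_def set_insert_at)

lemma leave_in_states: "C \<in> states N \<Longrightarrow> leave C j l \<in> states N"
  by (auto simp: states_def leave_def remove_at_def dest: in_set_takeD in_set_dropD)

lemma customer_in_states:
  assumes "C \<in> states N" "1 \<le> g" "g \<le> queue_length C j" "customer C j g = (i, s)"
  shows "1 \<le> s" "s \<le> len N i" "route N i s = j"
proof -
  have "(i, s) \<in> set (C j)" using assms nth_mem[of "g - 1" "C j"] by (simp add: customer_def)
  thus "1 \<le> s" "s \<le> len N i" "route N i s = j" using assms(1) by (auto simp: states_def)
qed

lemma customers_put: "customers (put N D i s h) = add_mset (i, s) (customers D)"
proof -
  let ?k = "route N i s"
  have "customers (put N D i s h) + mset (D ?k) = customers D + mset (insert_at h (i, s) (D ?k))"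
    unfolding put_def by (rule customers_upd)
  thus ?thesis by (simp add: mset_insert_at)
qed

lemma population_put: "population (put N D i s h) = Suc (population D)"
  by (simp add: customers_put)

lemma population_leave:
  "1 \<le> l \<Longrightarrow> l \<le> queue_length C j \<Longrightarrow> Suc (population (leave C j l)) = population C"
  using arg_cong[OF customers_leave, of l C j size] by simp

lemma finite_states_upto [simp]:
  fixes N :: "('i::finite, 'j::finite) network"
  shows "finite (states_upto N n)"
proof -
  let ?A = "Sigma UNIV (\<lambda>i. {1..len N i})"
  let ?B = "{xs. set xs \<subseteq> ?A \<and> length xs \<le> n}"
  have "queue_length C j \<le> population C" for C :: "('i, 'j) state" and j
    unfolding customers_def size_multiset_sum
    using member_le_sum[of j UNIV "\<lambda>j. size (mset (C j))"] by simp
  hence sub: "states_upto N n \<subseteq> {C. \<forall>j. (j \<in> UNIV \<longrightarrow> C j \<in> ?B) \<and> (j \<notin> UNIV \<longrightarrow> C j = [])}"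
    by (fastforce simp: states_upto_def states_def intro: order_trans)
  have fin: "finite ?B" by (intro finite_lists_length_le finite_SigmaI) auto
  show ?thesis by (rule finite_subset[OF sub finite_set_of_finite_funs[OF finite fin]])
qed

text \<open>A state together with an occupied position is the same as a state, a customer, and a position where
  this customer is put in. This change of variables is the combinatorial core of the balance equations;
  it is used once for the position that a customer leaves and once for the one that it occupies next.\<close>

lemma sum_pointed_states:
  fixes N :: "('i::finite, 'j::finite) network" and G :: "('i, 'j) state \<Rightarrow> 'j \<Rightarrow> nat \<Rightarrow> real"
  shows "(\<Sum>x\<in>states_upto N (Suc n). \<Sum>j\<in>UNIV. \<Sum>g=1..queue_length x j. G x j g) =
    (\<Sum>D\<in>states_upto N n. \<Sum>i\<in>UNIV. \<Sum>s=1..len N i. \<Sum>g=1..queue_length D (route N i s) + 1.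
       G (put N D i s g) (route N i s) g)"
proof -
  let ?L = "Sigma (states_upto N (Suc n)) (\<lambda>x. Sigma UNIV (\<lambda>j. {1..queue_length x j}))"
  let ?R = "Sigma (states_upto N n) (\<lambda>D. Sigma UNIV (\<lambda>i. Sigma {1..len N i}
              (\<lambda>s. {1..queue_length D (route N i s) + 1})))"
  have "(\<Sum>x\<in>states_upto N (Suc n). \<Sum>j\<in>UNIV. \<Sum>g=1..queue_length x j. G x j g) =
      (\<Sum>(x, j, g)\<in>?L. G x j g)"
    by (simp add: sum.Sigma)
  also have "\<dots> = (\<Sum>(D, i, s, g)\<in>?R. G (put N D i s g) (route N i s) g)"
  proof (rule sum.reindex_bij_witness)
    show "(\<lambda>(x, j, g). (leave x j g, fst (customer x j g), snd (customer x j g), g)) a \<in> ?R" if "a \<in> ?L" for a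
    proof -
      obtain x j g where a: "a = (x, j, g)" by (cases a)
      with that have x: "x \<in> states N" "population x \<le> Suc n" "1 \<le> g" "g \<le> queue_length x j"
        by (auto simp: states_upto_def)
      obtain i s where c: "customer x j g = (i, s)" by fastforce
      note stage = customer_in_states[OF x(1,3,4) c]
      have "queue_length (leave x j g) j + 1 = queue_length x j"
        using length_remove_at[OF x(3,4)] by (simp add: leave_def)
      thus ?thesis
        using a x c stage population_leave[where C = x and j = j, OF x(3,4)] leave_in_states[OF x(1)]
        by (simp add: states_upto_def)
    qed
    show "(\<lambda>(D, i, s, g). (put N D i s g, route N i s, g))
        ((\<lambda>(x, j, g). (leave x j g, fst (customer x j g), snd (customer x j g), g)) a) = a" if "a \<in> ?L" for a
    proof -
      obtain x j g where a: "a = (x, j, g)" by (cases a)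
      with that have x: "x \<in> states N" "1 \<le> g" "g \<le> queue_length x j"
        by (auto simp: states_upto_def)
      obtain i s where c: "customer x j g = (i, s)" by fastforce
      note stage = customer_in_states[OF x c]
      show ?thesis using a c put_leave[OF x(2,3) c stage(3)] stage by simp
    qed
    show "(case (case a of (x, j, g) \<Rightarrow> (leave x j g, fst (customer x j g), snd (customer x j g), g)) of
        (D, i, s, g) \<Rightarrow> G (put N D i s g) (route N i s) g) = (case a of (x, j, g) \<Rightarrow> G x j g)" if "a \<in> ?L" for a
    proof -
      obtain x j g where a: "a = (x, j, g)" by (cases a)
      with that have x: "x \<in> states N" "1 \<le> g" "g \<le> queue_length x j"
        by (auto simp: states_upto_def)
      obtain i s where c: "customer x j g = (i, s)" by fastforce
      note stage = customer_in_states[OF x c]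
      show ?thesis using a c put_leave[OF x(2,3) c stage(3)] stage by simp
    qed
  qed (auto simp: states_upto_def put_in_states population_put queue_length_put leave_put customer_put
         simp del: One_nat_def)
  also have "\<dots> = (\<Sum>D\<in>states_upto N n. \<Sum>i\<in>UNIV. \<Sum>s=1..len N i. \<Sum>g=1..queue_length D (route N i s) + 1.
       G (put N D i s g) (route N i s) g)"
    by (simp add: sum.Sigma del: sum.cl_ivl_Suc)
  finally show ?thesis .
qed

text \<open>Movements and departures merge into one sum over the occupied positions: the customer served there is
  sent to its next stage, which may be the outside.\<close>

lemma rate_eq_arrivals:
  fixes N :: "('i::finite, 'j::finite) network"
  assumes N: "open_network N" and C: "C \<in> states N"
  shows "rate N C y =
    (\<Sum>j\<in>UNIV. \<Sum>g=1..queue_length C j. srv N j g * vel N j (queue_length C j) g *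
       arrival_prob N (leave C j g) (fst (customer C j g)) (snd (customer C j g) + 1) y) +
    (\<Sum>i\<in>UNIV. arr N i * arrival_prob N C i 1 y)"
proof -
  have mv: "(\<Sum>(g, h) | can_move N C j g h \<and> move N C j g h = y.
        srv N j g * vel N j (queue_length C j) g * ins N (next_node N C j g) (dest_length N C j g) h) +
      (\<Sum>g | can_leave N C j g \<and> leave C j g = y. srv N j g * vel N j (queue_length C j) g) =
      (\<Sum>g=1..queue_length C j. srv N j g * vel N j (queue_length C j) g *
       arrival_prob N (leave C j g) (fst (customer C j g)) (snd (customer C j g) + 1) y)" (is "?m + ?l = ?r") for j
  proof -
    let ?w = "\<lambda>g. srv N j g * vel N j (queue_length C j) g"
    let ?more = "\<lambda>g. snd (customer C j g) < len N (fst (customer C j g))"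
    have "?m = (\<Sum>(g, h)\<in>Sigma {1..queue_length C j} (\<lambda>g. {1..dest_length N C j g}).
        ?w g * ins N (next_node N C j g) (dest_length N C j g) h * of_bool (?more g \<and> move N C j g h = y))"
      by (rule sum.mono_neutral_cong_left) (auto simp: can_move_def case_prod_beta)
    also have "\<dots> = (\<Sum>g=1..queue_length C j. \<Sum>h=1..dest_length N C j g.
        ?w g * ins N (next_node N C j g) (dest_length N C j g) h * of_bool (?more g \<and> move N C j g h = y))"
      by (rule sum.Sigma[symmetric]) auto
    finally have m: "?m = \<dots>" .
    have l: "?l = (\<Sum>g=1..queue_length C j. ?w g * of_bool (\<not> ?more g \<and> leave C j g = y))"
    proof (rule sum.mono_neutral_cong_left)
      have full: "\<not> ?more g \<longleftrightarrow> snd (customer C j g) = len N (fst (customer C j g))"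
        if "1 \<le> g" "g \<le> queue_length C j" for g
        using customer_in_states(2)[OF C that, of "fst (customer C j g)" "snd (customer C j g)"] by auto
      show "{g. can_leave N C j g \<and> leave C j g = y} \<subseteq> {1..queue_length C j}"
        by (auto simp: can_leave_def)
      show "\<forall>g\<in>{1..queue_length C j} - {g. can_leave N C j g \<and> leave C j g = y}.
          ?w g * of_bool (\<not> ?more g \<and> leave C j g = y) = 0"
        using full by (auto simp: can_leave_def case_prod_beta)
      show "?w g = ?w g * of_bool (\<not> ?more g \<and> leave C j g = y)"
        if "g \<in> {g. can_leave N C j g \<and> leave C j g = y}" for g
        using that by (auto simp: can_leave_def case_prod_beta)
    qed simp
    show ?thesis
      unfolding m l sum.distrib[symmetric]
    proof (rule sum.cong[OF refl])
      fix g assume "g \<in> {1..queue_length C j}"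
      hence g: "1 \<le> g" "g \<le> queue_length C j" by auto
      obtain i s where c: "customer C j g = (i, s)" by fastforce
      have nn: "next_node N C j g = route N i (s + 1)" by (simp add: next_node_def c)
      have dl: "dest_length N C j g = queue_length (leave C j g) (route N i (s + 1)) + 1"
        using length_remove_at[OF g] by (simp add: dest_length_def nn Let_def leave_def)
      show "(\<Sum>h=1..dest_length N C j g. ?w g * ins N (next_node N C j g) (dest_length N C j g) h *
              of_bool (?more g \<and> move N C j g h = y)) + ?w g * of_bool (\<not> ?more g \<and> leave C j g = y) =
            ?w g * arrival_prob N (leave C j g) (fst (customer C j g)) (snd (customer C j g) + 1) y"
        unfolding dl nn move_eq_put[OF c] c fst_conv snd_conv
        by (cases "s < len N i") (simp_all add: arrival_prob_def sum_distrib_left mult.assoc del: sum.cl_ivl_Suc sum_mult_of_bool_eq sum_of_bool_mult_eq)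
    qed
  qed
  have en: "(\<Sum>h | can_enter N C i h \<and> enter N C i h = y.
        arr N i * ins N (route N i 1) (queue_length C (route N i 1) + 1) h) =
      arr N i * arrival_prob N C i 1 y" for i
  proof -
    have "len N i \<ge> 1" using N by (simp add: open_network_def)
    hence "arr N i * arrival_prob N C i 1 y = (\<Sum>h=1..queue_length C (route N i 1) + 1.
        arr N i * ins N (route N i 1) (queue_length C (route N i 1) + 1) h * of_bool (enter N C i h = y))"
      unfolding enter_eq_put by (simp add: arrival_prob_def sum_distrib_left mult.assoc
          del: sum.cl_ivl_Suc sum_mult_of_bool_eq sum_of_bool_mult_eq)
    also have "\<dots> = (\<Sum>h | can_enter N C i h \<and> enter N C i h = y.
        arr N i * ins N (route N i 1) (queue_length C (route N i 1) + 1) h)"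
      by (rule sum.mono_neutral_cong_right) (auto simp: can_enter_def)
    finally show ?thesis by simp
  qed
  show ?thesis
    unfolding rate_def en mv[symmetric] sum.distrib by simp
qed

section \<open>Balance equations for the product form\<close>

lemma arrival_prob_population:
  assumes "arrival_prob N D i s y \<noteq> 0"
  shows "population y = (if s \<le> len N i then Suc (population D) else population D)"
proof (cases "s \<le> len N i")
  case True
  have "\<exists>h. put N D i s h = y"
  proof (rule ccontr)
    assume "\<nexists>h. put N D i s h = y"
    with True have "arrival_prob N D i s y = 0" by (simp add: arrival_prob_def)
    with assms show False by simp
  qed
  with True show ?thesis using population_put by auto
qed (use assms in \<open>auto simp: arrival_prob_def split: if_splits\<close>)

text \<open>The product-form measure up to normalisation. On \<open>states N\<close> a customer with entry \<open>(i, s)\<close> at node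
  \<open>j\<close> has \<open>alpha N j i s = arr N i\<close>.\<close>

definition equilibrium_weight :: "('i, 'j::finite) network \<Rightarrow> ('i, 'j) state \<Rightarrow> real" where
  "equilibrium_weight N C =
     (\<Prod>j\<in>UNIV. (\<Prod>c\<leftarrow>C j. arr N (fst c)) / (\<Prod>l=1..queue_length C j. srv N j l))"

definition remaining_work :: "('i, 'j::finite) network \<Rightarrow> ('i, 'j) state \<Rightarrow> nat" where
  "remaining_work N C = (\<Sum>(i, s)\<in>#customers C. len N i + 1 - s)"

text \<open>The condition on the service velocities says that node \<open>j\<close> with \<open>n\<close> customers completes services at
  total rate \<open>srv N j n\<close>, whichever positions these customers are served in.\<close>

locale full_rate_network =
  fixes N :: "('i::finite, 'j::finite) network"
  assumes network: "open_network N"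
    and total_rate: "n \<ge> 1 \<Longrightarrow> (\<Sum>l=1..n. srv N j l * vel N j n l) = srv N j n"
begin

lemma network_simps:
  shows arr_pos: "0 < arr N i" and len_pos: "1 \<le> len N i"
    and srv_pos: "1 \<le> l \<Longrightarrow> 0 < srv N j l"
    and vel_nonneg: "1 \<le> l \<Longrightarrow> l \<le> n \<Longrightarrow> 0 \<le> vel N j n l"
    and ins_nonneg: "1 \<le> l \<Longrightarrow> l \<le> n \<Longrightarrow> 0 \<le> ins N j n l"
    and sum_ins: "1 \<le> n \<Longrightarrow> (\<Sum>l=1..n. ins N j n l) = 1"
  using network by (auto simp: open_network_def)

lemma arrival_prob_nonneg: "0 \<le> arrival_prob N D i s y"
  unfolding arrival_prob_def by (auto intro!: sum_nonneg mult_nonneg_nonneg ins_nonneg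
    simp del: sum_mult_of_bool_eq sum.cl_ivl_Suc)

lemma arrival_prob_total:
  assumes D: "D \<in> states_upto N n" and s: "1 \<le> s"
  shows "(\<Sum>y\<in>states_upto N (Suc n). arrival_prob N D i s y) = 1"
proof (cases "s \<le> len N i")
  case True
  let ?m = "queue_length D (route N i s) + 1"
  have "(\<Sum>y\<in>states_upto N (Suc n). arrival_prob N D i s y) =
      (\<Sum>h=1..?m. \<Sum>y\<in>states_upto N (Suc n). ins N (route N i s) ?m h * (if put N D i s h = y then 1 else 0))"
    unfolding arrival_prob_def of_bool_def using True by (simp only: if_True) (rule sum.swap)
  also have "\<dots> = (\<Sum>h=1..?m. ins N (route N i s) ?m h)"
  proof (rule sum.cong[OF refl])
    fix h
    have "put N D i s h \<in> states_upto N (Suc n)"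
      using D put_in_states[OF _ s True] by (simp add: states_upto_def population_put)
    thus "(\<Sum>y\<in>states_upto N (Suc n). ins N (route N i s) ?m h * (if put N D i s h = y then 1 else 0)) =
        ins N (route N i s) ?m h"
      unfolding sum_distrib_left[symmetric] by simp
  qed
  also have "\<dots> = 1" by (rule sum_ins) simp
  finally show ?thesis .
next
  case False
  have "D \<in> states_upto N (Suc n)" using D by (simp add: states_upto_def)
  with False show ?thesis by (simp add: arrival_prob_def of_bool_def)
qed

lemma rate_nonneg: "0 \<le> rate N C D"
proof -
  have dest: "1 \<le> g \<and> g \<le> queue_length C j \<and> 1 \<le> h \<and> h \<le> dest_length N C j g" if "can_move N C j g h" for j g h
    using that by (simp add: can_move_def)
  show ?thesis
    unfolding rate_def
    by (intro add_nonneg_nonneg sum_nonneg)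
      (auto simp: can_leave_def can_enter_def
        intro!: mult_nonneg_nonneg vel_nonneg ins_nonneg less_imp_le[OF srv_pos] less_imp_le[OF arr_pos]
        dest!: dest)
qed

lemma rate_skip_free:
  assumes "rate N x y \<noteq> 0"
  shows "population x \<le> Suc (population y) \<and> population y \<le> Suc (population x)"
proof (rule ccontr)
  assume far: "\<not> ?thesis"
  have "{(g, h). can_move N x j g h \<and> move N x j g h = y} = {}" for j
    using far size_customers_move by fastforce
  moreover have "{g. can_leave N x j g \<and> leave x j g = y} = {}" for j
    using far size_customers_leave by fastforce
  moreover have "{h. can_enter N x i h \<and> enter N x i h = y} = {}" for i
    using far size_customers_enter[of N x i] by auto
  ultimately have "rate N x y = 0" by (simp only: rate_def) simp
  with assms show False by simp
qed

lemma leave_in_states_upto: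
  assumes "x \<in> states N" "g \<in> {1..queue_length x j}"
  shows "leave x j g \<in> states_upto N (population x)"
  using population_leave[of g x j] assms leave_in_states[OF assms(1)] by (simp add: states_upto_def)

lemma rate_total:
  assumes x: "x \<in> states N"
  shows "(\<Sum>y\<in>states_upto N (Suc (population x)). rate N x y) =
    (\<Sum>j\<in>UNIV. \<Sum>g=1..queue_length x j. srv N j g * vel N j (queue_length x j) g) + (\<Sum>i\<in>UNIV. arr N i)"
proof -
  let ?S = "states_upto N (Suc (population x))"
  let ?w = "\<lambda>j g. srv N j g * vel N j (queue_length x j) g"
  let ?a = "\<lambda>j g. arrival_prob N (leave x j g) (fst (customer x j g)) (snd (customer x j g) + 1)"
  have "(\<Sum>y\<in>?S. rate N x y) = (\<Sum>y\<in>?S. \<Sum>j\<in>UNIV. \<Sum>g=1..queue_length x j. ?w j g * ?a j g y) +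
      (\<Sum>y\<in>?S. \<Sum>i\<in>UNIV. arr N i * arrival_prob N x i 1 y)"
    by (simp add: rate_eq_arrivals[OF network x] sum.distrib)
  also have "(\<Sum>y\<in>?S. \<Sum>i\<in>UNIV. arr N i * arrival_prob N x i 1 y) =
      (\<Sum>i\<in>UNIV. arr N i * (\<Sum>y\<in>?S. arrival_prob N x i 1 y))"
    by (subst sum.swap) (simp add: sum_distrib_left)
  also have "\<dots> = (\<Sum>i\<in>UNIV. arr N i)"
    using x by (subst arrival_prob_total) (auto simp: states_upto_def)
  also have "(\<Sum>y\<in>?S. \<Sum>j\<in>UNIV. \<Sum>g=1..queue_length x j. ?w j g * ?a j g y) =
      (\<Sum>j\<in>UNIV. \<Sum>g=1..queue_length x j. \<Sum>y\<in>?S. ?w j g * ?a j g y)"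
    by (subst sum.swap, rule sum.cong[OF refl], rule sum.swap)
  also have "\<dots> = (\<Sum>j\<in>UNIV. \<Sum>g=1..queue_length x j. ?w j g)"
    by (intro sum.cong refl, unfold sum_distrib_left[symmetric], subst arrival_prob_total)
      (use leave_in_states_upto[OF x] in auto)
  finally show ?thesis .
qed

text \<open>Only arrivals from outside increase the number of customers.\<close>

lemma rate_up_bounded:
  assumes x: "x \<in> states N"
  shows "(\<Sum>y | y \<in> states N \<and> population y = Suc (population x). rate N x y) \<le> (\<Sum>i\<in>UNIV. arr N i)"
proof -
  let ?S = "states_upto N (Suc (population x))"
  let ?U = "{y \<in> states N. population y = Suc (population x)}"
  have "rate N x y = (\<Sum>i\<in>UNIV. arr N i * arrival_prob N x i 1 y)" if y: "y \<in> ?U" for y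
  proof -
    have "arrival_prob N (leave x j g) i s y = 0" if "g \<in> {1..queue_length x j}" for j g i s
    proof (rule ccontr)
      assume "arrival_prob N (leave x j g) i s y \<noteq> 0"
      from arrival_prob_population[OF this] show False
        using y population_leave[of g x j] that by (auto split: if_splits)
    qed
    hence "(\<Sum>j\<in>UNIV. \<Sum>g=1..queue_length x j. srv N j g * vel N j (queue_length x j) g *
       arrival_prob N (leave x j g) (fst (customer x j g)) (snd (customer x j g) + 1) y) = 0"
      by (intro sum.neutral ballI) simp
    thus ?thesis using rate_eq_arrivals[OF network x, of y] by simp
  qed
  hence "(\<Sum>y\<in>?U. rate N x y) = (\<Sum>y\<in>?U. \<Sum>i\<in>UNIV. arr N i * arrival_prob N x i 1 y)"
    by (rule sum.cong[OF refl])
  also have "\<dots> \<le> (\<Sum>y\<in>?S. \<Sum>i\<in>UNIV. arr N i * arrival_prob N x i 1 y)"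
    by (intro sum_mono2)
      (auto simp: states_upto_def[symmetric] intro!: sum_nonneg mult_nonneg_nonneg arrival_prob_nonneg less_imp_le[OF arr_pos],
       simp add: states_upto_def)
  also have "\<dots> = (\<Sum>i\<in>UNIV. arr N i * (\<Sum>y\<in>?S. arrival_prob N x i 1 y))"
    by (subst sum.swap) (simp add: sum_distrib_left)
  also have "\<dots> = (\<Sum>i\<in>UNIV. arr N i)"
    using x by (subst arrival_prob_total) (auto simp: states_upto_def)
  finally show ?thesis .
qed

sublocale skip_free_rates "states N" population "rate N" "\<Sum>i\<in>UNIV. arr N i"
proof
  show "finite {x \<in> states N. population x \<le> n}" for n
    using finite_states_upto[of N n] by (simp add: states_upto_def)
qed (use rate_nonneg rate_skip_free rate_up_bounded in auto)

lemma below_eq_states_upto: "below n = states_upto N n"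
  by (simp add: below_def states_upto_def)

text \<open>The factor by which one more customer changes the weight depends on its type and on the new queue
  length only, neither on its position nor on the rest of the state. This locality is what makes the
  product form balance.\<close>

lemma equilibrium_weight_put:
  assumes "1 \<le> g" "g \<le> queue_length D (route N i s) + 1"
  shows "equilibrium_weight N (put N D i s g) * srv N (route N i s) (queue_length D (route N i s) + 1) =
    equilibrium_weight N D * arr N i"
proof -
  let ?k = "route N i s"
  let ?f = "\<lambda>C j. (\<Prod>c\<leftarrow>C j. arr N (fst c)) / (\<Prod>l=1..queue_length C j. srv N j l)"
  let ?x = "put N D i s g"
  have "(\<Prod>c\<leftarrow>?x ?k. arr N (fst c)) = prod_mset (image_mset (arr N \<circ> fst) (mset (?x ?k)))"
    by (simp add: prod_mset_prod_list[symmetric] comp_def)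
  also have "\<dots> = arr N i * (\<Prod>c\<leftarrow>D ?k. arr N (fst c))"
    by (simp add: put_def mset_insert_at prod_mset_prod_list[symmetric] comp_def)
  finally have here: "?f ?x ?k * srv N ?k (queue_length D ?k + 1) = ?f D ?k * arr N i"
    using srv_pos[of "queue_length D ?k + 1" ?k] by (simp add: queue_length_put[of g D N i s, OF assms])
  have elsewhere: "(\<Prod>j\<in>UNIV - {?k}. ?f ?x j) = (\<Prod>j\<in>UNIV - {?k}. ?f D j)"
    by (rule prod.cong) (auto simp: put_def)
  have split: "equilibrium_weight N C = ?f C ?k * (\<Prod>j\<in>UNIV - {?k}. ?f C j)" for C
    unfolding equilibrium_weight_def by (rule prod.remove) auto
  have "equilibrium_weight N ?x * srv N ?k (queue_length D ?k + 1) =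
      (?f ?x ?k * srv N ?k (queue_length D ?k + 1)) * (\<Prod>j\<in>UNIV - {?k}. ?f D j)"
    unfolding split elsewhere by (simp only: ac_simps)
  also have "\<dots> = equilibrium_weight N D * arr N i"
    unfolding here split by (simp only: ac_simps)
  finally show ?thesis .
qed

text \<open>Fix a customer with its type \<open>i\<close> and the state \<open>D\<close> of all others. Summed over the positions from
  which this customer may come, weight times service rate is \<open>w D * arr N i\<close>: by
  \<open>equilibrium_weight_put\<close> the weight carries the inverse of the total service rate of the node. This
  no longer depends on the stage or node that the customer leaves, and it is also the rate at which new
  customers of type \<open>i\<close> appear in \<open>D\<close>. So the inflow into \<open>y\<close> is \<open>w D * arr N i\<close> times the arrival
  probabilities, summed over all stages from 1 to \<open>len N i + 1\<close>. The last stage yields the total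
  arrival rate. The others, rewritten in terms of \<open>y\<close> and the position of the customer who has just
  arrived, yield the total service rate in \<open>y\<close>, as the probabilities of the positions sum to 1.\<close>

theorem equilibrium_balance:
  assumes y: "y \<in> states N"
  shows "inflow (equilibrium_weight N) y = equilibrium_weight N y * outrate y"
proof -
  define w where "w = equilibrium_weight N"
  define n where "n = population y"
  let ?S = "states_upto N n"
  let ?A = "\<lambda>D i s. arrival_prob N D i s y"
  have y': "y \<in> ?S" "y \<in> states_upto N (Suc n)" using y by (auto simp: states_upto_def n_def)
  \<comment> \<open>Both sides are the total service rate of the node, or 0 if it is empty.\<close>
  have service: "(\<Sum>g=1..queue_length C j. srv N j g * vel N j (queue_length C j) g) =
      (\<Sum>g=1..queue_length C j. srv N j (queue_length C j) * ins N j (queue_length C j) g)" for C :: "('i, 'j) state" and j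
  proof (cases "queue_length C j")
    case (Suc m)
    show ?thesis using total_rate[of "queue_length C j" j] sum_ins[of "queue_length C j" j] Suc
      by (simp add: sum_distrib_left[symmetric] del: sum.cl_ivl_Suc)
  qed simp
  \<comment> \<open>Transitions caused by a service completion: the position that the customer leaves is summed out.\<close>
  have "(\<Sum>x\<in>states_upto N (Suc n). \<Sum>j\<in>UNIV. \<Sum>g=1..queue_length x j.
        w x * (srv N j g * vel N j (queue_length x j) g * ?A (leave x j g) (fst (customer x j g)) (snd (customer x j g) + 1))) =
      (\<Sum>D\<in>?S. \<Sum>i\<in>UNIV. \<Sum>s=1..len N i. w D * arr N i * ?A D i (s + 1))"
    unfolding sum_pointed_states
  proof (intro sum.cong refl)
    fix D i s assume "D \<in> ?S" "s \<in> {1..len N i}"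
    let ?k = "route N i s"
    let ?m = "queue_length D ?k + 1"
    have "(\<Sum>g=1..?m. w (put N D i s g) * (srv N ?k g * vel N ?k (queue_length (put N D i s g) ?k) g *
          ?A (leave (put N D i s g) ?k g) (fst (customer (put N D i s g) ?k g)) (snd (customer (put N D i s g) ?k g) + 1))) =
        (\<Sum>g=1..?m. w D * arr N i * ?A D i (s + 1) / srv N ?k ?m * (srv N ?k g * vel N ?k ?m g))"
    proof (rule sum.cong[OF refl])
      fix g assume "g \<in> {1..?m}"
      hence g: "1 \<le> g" "g \<le> ?m" by auto
      have "w (put N D i s g) = w D * arr N i / srv N ?k ?m"
        using equilibrium_weight_put[of g D i s, OF g] srv_pos[of ?m ?k] by (simp add: w_def field_simps)
      thus "w (put N D i s g) * (srv N ?k g * vel N ?k (queue_length (put N D i s g) ?k) g *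
          ?A (leave (put N D i s g) ?k g) (fst (customer (put N D i s g) ?k g)) (snd (customer (put N D i s g) ?k g) + 1)) =
          w D * arr N i * ?A D i (s + 1) / srv N ?k ?m * (srv N ?k g * vel N ?k ?m g)"
        unfolding leave_put[of g D N i s, OF g] customer_put[of g D N i s, OF g] queue_length_put[of g D N i s, OF g] by simp
    qed
    also have "\<dots> = w D * arr N i * ?A D i (s + 1)"
      unfolding sum_distrib_left[symmetric] using total_rate[of ?m ?k] srv_pos[of ?m ?k] by simp
    finally show "(\<Sum>g=1..?m. w (put N D i s g) * (srv N ?k g * vel N ?k (queue_length (put N D i s g) ?k) g *
          ?A (leave (put N D i s g) ?k g) (fst (customer (put N D i s g) ?k g)) (snd (customer (put N D i s g) ?k g) + 1))) =
        w D * arr N i * ?A D i (s + 1)" .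
  qed
  \<comment> \<open>Arrivals from outside: \<open>y\<close> is reached from a state with one customer less.\<close>
  moreover have "(\<Sum>x\<in>states_upto N (Suc n). \<Sum>i\<in>UNIV. w x * arr N i * ?A x i 1) =
      (\<Sum>D\<in>?S. \<Sum>i\<in>UNIV. w D * arr N i * ?A D i 1)"
  proof (rule sum.mono_neutral_right)
    show "\<forall>x\<in>states_upto N (Suc n) - ?S. (\<Sum>i\<in>UNIV. w x * arr N i * ?A x i 1) = 0"
    proof
      fix x assume "x \<in> states_upto N (Suc n) - ?S"
      hence "population x > n" by (auto simp: states_upto_def)
      hence "?A x i 1 = 0" for i
        using arrival_prob_population[of N x i 1 y] len_pos[of i] by (auto simp: n_def)
      thus "(\<Sum>i\<in>UNIV. w x * arr N i * ?A x i 1) = 0" by simp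
    qed
  qed (auto simp: states_upto_def[of N "Suc n"] states_upto_def[of N n] finite_levels)
  moreover have "inflow w y = (\<Sum>x\<in>states_upto N (Suc n). \<Sum>j\<in>UNIV. \<Sum>g=1..queue_length x j.
        w x * (srv N j g * vel N j (queue_length x j) g * ?A (leave x j g) (fst (customer x j g)) (snd (customer x j g) + 1))) +
      (\<Sum>x\<in>states_upto N (Suc n). \<Sum>i\<in>UNIV. w x * arr N i * ?A x i 1)"
    unfolding inflow_def below_eq_states_upto n_def[symmetric] sum.distrib[symmetric]
    by (intro sum.cong refl, subst rate_eq_arrivals[OF network])
      (auto simp: states_upto_def distrib_left sum_distrib_left mult.assoc simp del: sum.cl_ivl_Suc)
  ultimately have "inflow w y = (\<Sum>D\<in>?S. \<Sum>i\<in>UNIV. w D * arr N i * (\<Sum>s=1..len N i. ?A D i (s + 1))) +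
      (\<Sum>D\<in>?S. \<Sum>i\<in>UNIV. w D * arr N i * ?A D i 1)"
    by (simp add: sum_distrib_left)
  also have "\<dots> = (\<Sum>D\<in>?S. \<Sum>i\<in>UNIV. w D * arr N i * ((\<Sum>s=1..len N i. ?A D i (s + 1)) + ?A D i 1))"
    by (simp add: sum.distrib distrib_left)
  \<comment> \<open>Split the stages \<open>1, ..., len N i + 1\<close> at the last one instead of the first.\<close>
  also have "\<dots> = (\<Sum>D\<in>?S. \<Sum>i\<in>UNIV. w D * arr N i * ((\<Sum>s=1..len N i. ?A D i s) + of_bool (D = y)))"
  proof (intro sum.cong refl arg_cong2[where f = "(*)"])
    fix D i
    have "(\<Sum>s=1..len N i. ?A D i (s + 1)) + ?A D i 1 = (\<Sum>s=1..len N i + 1. ?A D i s)"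
      using sum.atLeast_Suc_atMost[of 1 "len N i + 1" "?A D i"] sum.shift_bounds_cl_Suc_ivl[of "?A D i" 1 "len N i"]
      by (simp del: sum.cl_ivl_Suc)
    also have "\<dots> = (\<Sum>s=1..len N i. ?A D i s) + ?A D i (len N i + 1)" by simp
    also have "?A D i (len N i + 1) = of_bool (D = y)" by (simp add: arrival_prob_def)
    finally show "(\<Sum>s=1..len N i. ?A D i (s + 1)) + ?A D i 1 = (\<Sum>s=1..len N i. ?A D i s) + of_bool (D = y)" .
  qed
  also have "\<dots> = (\<Sum>D\<in>?S. \<Sum>i\<in>UNIV. \<Sum>s=1..len N i. w D * arr N i * ?A D i s) + (\<Sum>D\<in>?S. if D = y then w y * (\<Sum>i\<in>UNIV. arr N i) else 0)"
    unfolding sum.distrib[symmetric]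
  proof (rule sum.cong[OF refl])
    fix D
    show "(\<Sum>i\<in>UNIV. w D * arr N i * ((\<Sum>s=1..len N i. ?A D i s) + of_bool (D = y))) =
        (\<Sum>i\<in>UNIV. \<Sum>s=1..len N i. w D * arr N i * ?A D i s) + (if D = y then w y * (\<Sum>i\<in>UNIV. arr N i) else 0)"
      by (cases "D = y") (simp_all add: distrib_left sum.distrib sum_distrib_left)
  qed
  also have "(\<Sum>D\<in>?S. if D = y then w y * (\<Sum>i\<in>UNIV. arr N i) else 0) = w y * (\<Sum>i\<in>UNIV. arr N i)"
    using y' by simp
  also
  let ?F = "\<lambda>x j r. of_bool (x = y) * (w x * (srv N j (queue_length x j) * ins N j (queue_length x j) r))"
  have "(\<Sum>D\<in>?S. \<Sum>i\<in>UNIV. \<Sum>s=1..len N i. w D * arr N i * ?A D i s) =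
      (\<Sum>D\<in>?S. \<Sum>i\<in>UNIV. \<Sum>s=1..len N i. \<Sum>r=1..queue_length D (route N i s) + 1.
         ?F (put N D i s r) (route N i s) r)"
  proof (intro sum.cong refl)
    fix D :: "('i, 'j) state" and i s assume s: "s \<in> {1..len N i}"
    let ?k = "route N i s"
    let ?m = "queue_length D ?k + 1"
    have "w D * arr N i * ?A D i s = (\<Sum>r=1..?m. of_bool (put N D i s r = y) * (w D * arr N i * ins N ?k ?m r))"
      using s by (simp add: arrival_prob_def sum_distrib_left ac_simps del: sum.cl_ivl_Suc sum_mult_of_bool_eq sum_of_bool_mult_eq)
    also have "\<dots> = (\<Sum>r=1..?m. ?F (put N D i s r) ?k r)"
    proof (rule sum.cong[OF refl])
      fix r assume "r \<in> {1..?m}"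
      hence r: "1 \<le> r" "r \<le> ?m" by auto
      show "of_bool (put N D i s r = y) * (w D * arr N i * ins N ?k ?m r) = ?F (put N D i s r) ?k r"
        unfolding queue_length_put[of r D N i s, OF r] w_def equilibrium_weight_put[of r D i s, OF r, symmetric] by (simp only: mult.assoc)
    qed
    finally show "w D * arr N i * ?A D i s = \<dots>" .
  qed
  also have "\<dots> = (\<Sum>x\<in>states_upto N (Suc n). \<Sum>j\<in>UNIV. \<Sum>r=1..queue_length x j. ?F x j r)"
    by (rule sum_pointed_states[symmetric])
  also have "\<dots> = (\<Sum>x\<in>states_upto N (Suc n). if x = y then w y * (\<Sum>j\<in>UNIV. \<Sum>r=1..queue_length y j. srv N j (queue_length y j) * ins N j (queue_length y j) r) else 0)"
    by (intro sum.cong refl) (auto simp: sum_distrib_left)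
  also have "\<dots> = w y * (\<Sum>j\<in>UNIV. \<Sum>r=1..queue_length y j. srv N j (queue_length y j) * ins N j (queue_length y j) r)"
    using y' by simp
  also have "\<dots> + w y * (\<Sum>i\<in>UNIV. arr N i) = w y * outrate y"
    unfolding outrate_def below_eq_states_upto rate_total[OF y] distrib_left service ..
  finally show ?thesis unfolding w_def .
qed

lemma remaining_work_put: "remaining_work N (put N D i s h) = (len N i + 1 - s) + remaining_work N D"
  by (simp add: remaining_work_def customers_put)

text \<open>Some position of each nonempty node is served at a positive rate, as the rates of its positions sum to
  a positive number; completing that service takes the customer one stage further. Hence the empty
  state can be reached from everywhere, though not every customer present need be in service.\<close>

lemma work_decreases:
  assumes x: "x \<in> states N" "x \<noteq> (\<lambda>_. [])"
  shows "\<exists>y\<in>states N. remaining_work N y < remaining_work N x \<and> 0 < rate N x y"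
proof -
  obtain j where j: "x j \<noteq> []" using x(2) by (auto simp: fun_eq_iff)
  let ?n = "queue_length x j"
  have "0 < (\<Sum>g=1..?n. srv N j g * vel N j ?n g)"
    using total_rate[of ?n j] srv_pos[of ?n j] j by (simp add: Suc_le_eq)
  then obtain g where "g \<in> {1..?n}" and pos: "0 < srv N j g * vel N j ?n g"
    by (meson not_less sum_nonpos)
  hence g: "1 \<le> g" "g \<le> ?n" by auto
  obtain i s where c: "customer x j g = (i, s)" by fastforce
  note stage = customer_in_states[OF x(1) g c]
  let ?D = "leave x j g"
  have D: "?D \<in> states N" by (rule leave_in_states[OF x(1)])
  have work: "remaining_work N x = (len N i + 1 - s) + remaining_work N ?D"
    using remaining_work_put[of ?D i s g] put_leave[OF g c stage(3)] by simp
  have rate: "srv N j g * vel N j ?n g * arrival_prob N ?D i (s + 1) y \<le> rate N x y" for y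
  proof -
    let ?t = "\<lambda>j g. srv N j g * vel N j (queue_length x j) g *
       arrival_prob N (leave x j g) (fst (customer x j g)) (snd (customer x j g) + 1) y"
    have t: "0 \<le> ?t k h" if "h \<in> {1..queue_length x k}" for k h
      using that by (intro mult_nonneg_nonneg arrival_prob_nonneg vel_nonneg less_imp_le[OF srv_pos]) auto
    have "?t j g \<le> (\<Sum>h=1..?n. ?t j h)" by (rule member_le_sum) (use g t in auto)
    also have "\<dots> \<le> (\<Sum>j\<in>UNIV. \<Sum>h=1..queue_length x j. ?t j h)"
      by (rule member_le_sum[where f = "\<lambda>j. \<Sum>h=1..queue_length x j. ?t j h"]) (use t in \<open>auto intro: sum_nonneg\<close>)
    also have "\<dots> \<le> rate N x y"
      unfolding rate_eq_arrivals[OF network x(1)]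
      by (simp add: sum_nonneg arrival_prob_nonneg less_imp_le[OF arr_pos])
    finally show ?thesis by (simp add: c)
  qed
  have "\<exists>y\<in>states N. remaining_work N y < remaining_work N x \<and> 0 < arrival_prob N ?D i (s + 1) y"
  proof (cases "s < len N i")
    case True
    let ?m = "queue_length ?D (route N i (s + 1)) + 1"
    have "0 < (\<Sum>h=1..?m. ins N (route N i (s + 1)) ?m h)" by (subst sum_ins) auto
    then obtain h where h: "h \<in> {1..?m}" "0 < ins N (route N i (s + 1)) ?m h"
      by (meson not_less sum_nonpos)
    let ?y = "put N ?D i (s + 1) h"
    have "ins N (route N i (s + 1)) ?m h * of_bool (?y = ?y) \<le> arrival_prob N ?D i (s + 1) ?y"
      unfolding arrival_prob_def using True
      by (simp only: if_True Suc_eq_plus1[symmetric] Suc_le_eq)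
        (rule member_le_sum, use h in \<open>auto intro!: ins_nonneg\<close>)
    with h(2) have "0 < arrival_prob N ?D i (s + 1) ?y" by simp
    moreover have "?y \<in> states N" by (rule put_in_states[OF D]) (use True in auto)
    moreover have "remaining_work N ?y < remaining_work N x" using True by (simp add: remaining_work_put work)
    ultimately show ?thesis by blast
  next
    case False
    thus ?thesis using D work stage(2) by (intro bexI[of _ ?D]) (auto simp: arrival_prob_def)
  qed
  then obtain y where "y \<in> states N" "remaining_work N y < remaining_work N x" "0 < arrival_prob N ?D i (s + 1) y" by blast
  thus ?thesis using rate[of y] mult_pos_pos[OF pos] by (intro bexI[of _ y]) (auto intro: less_le_trans)
qed

lemma infsum_rate:
  assumes y: "y \<in> states N"
  shows "infsum (rate N y) (states N - {y}) = outrate y - rate N y y"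
proof -
  let ?S = "below (Suc (population y))"
  have "infsum (rate N y) (states N - {y}) = infsum (rate N y) (?S - {y})"
    by (rule infsum_cong_neutral) (use rate_skip_free in \<open>auto simp: below_def\<close>)
  also have "\<dots> = sum (rate N y) (?S - {y})" by simp
  also have "\<dots> = outrate y - rate N y y"
    unfolding outrate_def using y by (subst sum_diff1) (auto simp: below_def finite_levels)
  finally show ?thesis .
qed

end

section \<open>Independent identically distributed lists and laws on countable sets\<close>

lemma pmf_replicate:
  "pmf (replicate_pmf n p) xs = (if length xs = n then (\<Prod>x\<leftarrow>xs. pmf p x) else 0)"
proof (induction n arbitrary: xs)
  case 0
  show ?case by (cases xs) auto
next
  case (Suc n)
  have rep: "replicate_pmf (Suc n) p = map_pmf (\<lambda>(x, xs). x # xs) (pair_pmf p (replicate_pmf n p))"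
    by (simp add: pair_pmf_def map_bind_pmf)
  show ?case
  proof (cases xs)
    case Nil
    have "[] \<notin> set_pmf (replicate_pmf (Suc n) p)" by (auto simp: set_replicate_pmf)
    thus ?thesis using Nil by (simp add: set_pmf_iff del: replicate_pmf.simps)
  next
    case (Cons y ys)
    have "inj (\<lambda>(x :: 'a, xs). x # xs)" by (auto simp: inj_on_def)
    from pmf_map_inj'[OF this, of "pair_pmf p (replicate_pmf n p)" "(y, ys)"]
    show ?thesis unfolding rep Cons by (simp add: pmf_pair Suc.IH)
  qed
qed

lemma map_nth_replicate_pmf:
  "k < n \<Longrightarrow> map_pmf (\<lambda>xs. xs ! k) (replicate_pmf n p) = p"
proof (induction n arbitrary: k)
  case (Suc n)
  show ?case
  proof (cases k)
    case 0
    thus ?thesis by (simp add: map_bind_pmf bind_return_pmf')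
  next
    case (Suc m)
    have "map_pmf (\<lambda>xs. xs ! k) (replicate_pmf (Suc n) p) = p \<bind> (\<lambda>_. map_pmf (\<lambda>xs. xs ! m) (replicate_pmf n p))"
      unfolding Suc by (simp add: map_pmf_def bind_assoc_pmf bind_return_pmf)
    thus ?thesis using Suc.IH[of m] Suc.prems Suc by simp
  qed
qed simp

lemma emeasure_replicate_pmf_nth:
  "emeasure (replicate_pmf n p) {xs. k < length xs \<and> xs ! k = c} = ennreal (pmf p c) * indicator {k<..} n"
proof (cases "k < n")
  case True
  have "measure_pmf.prob (replicate_pmf n p) {xs. k < length xs \<and> xs ! k = c} =
      measure_pmf.prob (replicate_pmf n p) ((\<lambda>xs. xs ! k) -` {c})"
    by (rule measure_prob_cong_0) (use True in \<open>auto simp: pmf_replicate\<close>)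
  also have "\<dots> = measure_pmf.prob (map_pmf (\<lambda>xs. xs ! k) (replicate_pmf n p)) {c}" by simp
  also have "\<dots> = pmf p c" unfolding map_nth_replicate_pmf[OF True] by (rule measure_pmf_single)
  finally show ?thesis using True by (simp add: measure_pmf.emeasure_eq_measure)
next
  case False
  have "measure_pmf.prob (replicate_pmf n p) {xs. k < length xs \<and> xs ! k = c} = measure_pmf.prob (replicate_pmf n p) {}"
    by (rule measure_prob_cong_0) (use False in \<open>auto simp: pmf_replicate\<close>)
  thus ?thesis using False by (simp add: measure_pmf.emeasure_eq_measure)
qed

lemma law_as_pmf:
  assumes "prob_space M" "countable S" "X \<in> measurable M (count_space S)"
  obtains P where "set_pmf P \<subseteq> S" "measure_pmf P = distr M (count_space UNIV) X"
proof -
  interpret prob_space M by fact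
  have X: "X \<in> measurable M (count_space UNIV)"
    using measurable_compose[OF assms(3), of "\<lambda>x. x"] by simp
  let ?D = "distr M (count_space UNIV) X"
  interpret D: prob_space ?D by (rule prob_space_distr[OF X])
  have "AE \<omega> in M. X \<omega> \<in> S" using measurable_space[OF assms(3)] by simp
  hence S: "AE x in ?D. x \<in> S" by (subst AE_distr_iff[OF X]) auto
  hence "AE x in ?D. measure ?D {x} \<noteq> 0"
    using D.AE_support_countable assms(2) by auto
  hence D: "measure_pmf (Abs_pmf ?D) = ?D"
    by (intro Abs_pmf_inverse) (simp add: D.prob_space_axioms)
  have "AE x in measure_pmf (Abs_pmf ?D). x \<in> S" unfolding D by (rule S)
  hence "set_pmf (Abs_pmf ?D) \<subseteq> S" by (auto simp: AE_measure_pmf_iff)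
  with D show ?thesis using that by blast
qed

lemma prob_eq_pmf:
  assumes "X \<in> measurable M (count_space S)" "measure_pmf P = distr M (count_space UNIV) X"
  shows "\<P>(\<omega> in M. Q (X \<omega>)) = measure_pmf.prob P {x. Q x}"
proof -
  have X: "X \<in> measurable M (count_space UNIV)"
    using measurable_compose[OF assms(1), of "\<lambda>x. x"] by simp
  show ?thesis unfolding assms(2) by (subst measure_distr[OF X]) (auto intro: arg_cong[where f = "measure M"])
qed

lemma indep_vars_if_indep_vars_law:
  assumes M: "prob_space M" and X: "X \<in> measurable M (count_space S)"
    and P: "measure_pmf P = distr M (count_space UNIV) X"
    and indep: "prob_space.indep_vars (measure_pmf P) (\<lambda>_. count_space UNIV) f I" and I: "I \<noteq> {}"
  shows "prob_space.indep_vars M (\<lambda>_. count_space UNIV) (\<lambda>i \<omega>. f i (X \<omega>)) I"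
proof -
  interpret prob_space M by fact
  have X': "X \<in> measurable M (count_space UNIV)"
    using measurable_compose[OF X, of "\<lambda>x. x"] by simp
  have meas: "(\<lambda>\<omega>. f i (X \<omega>)) \<in> measurable M (count_space UNIV)" for i
    by (rule measurable_compose[OF X']) simp
  have "distr M (\<Pi>\<^sub>M i\<in>I. count_space UNIV) (\<lambda>\<omega>. \<lambda>i\<in>I. f i (X \<omega>)) =
      distr (measure_pmf P) (\<Pi>\<^sub>M i\<in>I. count_space UNIV) (\<lambda>x. \<lambda>i\<in>I. f i x)"
    unfolding P by (subst distr_distr[OF _ X']) (auto simp: space_PiM comp_def)
  also have "\<dots> = (\<Pi>\<^sub>M i\<in>I. distr (measure_pmf P) (count_space UNIV) (f i))"
    using indep by (subst (asm) prob_space.indep_vars_iff_distr_eq_PiM'[OF prob_space_measure_pmf I]) auto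
  also have "\<dots> = (\<Pi>\<^sub>M i\<in>I. distr M (count_space UNIV) (\<lambda>\<omega>. f i (X \<omega>)))"
    unfolding P by (subst distr_distr[OF _ X']) (auto simp: comp_def)
  finally show ?thesis
    using meas by (subst indep_vars_iff_distr_eq_PiM'[OF I]) auto
qed

section \<open>The stationary distribution of the network\<close>

locale stable_network = full_rate_network N for N :: "('i::finite, 'j::finite) network" +
  assumes finite_norm: "summable (\<lambda>n. load N j ^ n / (\<Prod>l=1..n. srv N j l))"
begin

lemma load_nonneg: "0 \<le> load N j"
  unfolding load_def alpha_def by (intro sum_nonneg) (auto intro: less_imp_le[OF arr_pos])

lemma load_term_nonneg: "0 \<le> load N j ^ n / (\<Prod>l=1..n. srv N j l)"
  by (intro divide_nonneg_nonneg zero_le_power load_nonneg prod_nonneg) (auto intro: less_imp_le[OF srv_pos])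

lemma norm_const_pos: "0 < norm_const N j"
proof -
  have "0 < (\<Sum>n. load N j ^ n / (\<Prod>l=1..n. srv N j l))"
    by (rule suminf_pos2[where i = 0, OF finite_norm load_term_nonneg]) simp
  thus ?thesis by (simp add: norm_const_def)
qed

text \<open>The product-form distribution as an experiment: independently at each node, draw the queue length,
  then the types and stages of the customers independently and identically distributed. Written this
  way it is visibly a probability distribution and has all the properties in question; that it is the
  normalised product-form weight is shown below.\<close>

definition length_pmf :: "'j \<Rightarrow> nat pmf" where
  "length_pmf j = embed_pmf (\<lambda>n. norm_const N j * load N j ^ n / (\<Prod>l=1..n. srv N j l))"

text \<open>Meaningful only for \<open>load N j > 0\<close>; otherwise node \<open>j\<close> is always empty and no customer is drawn.\<close>

definition customer_pmf :: "'j \<Rightarrow> ('i \<times> nat) pmf" where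
  "customer_pmf j = embed_pmf (\<lambda>(i, s). if s \<in> {1..len N i} then alpha N j i s / load N j else 0)"

definition node_pmf :: "'j \<Rightarrow> ('i \<times> nat) list pmf" where
  "node_pmf j = length_pmf j \<bind> (\<lambda>n. replicate_pmf n (customer_pmf j))"

definition equilibrium_pmf :: "('i, 'j) state pmf" where
  "equilibrium_pmf = Pi_pmf UNIV [] node_pmf"

lemma pmf_length: "pmf (length_pmf j) n = norm_const N j * load N j ^ n / (\<Prod>l=1..n. srv N j l)"
  unfolding length_pmf_def
proof (rule pmf_embed_pmf)
  let ?a = "\<lambda>n. load N j ^ n / (\<Prod>l=1..n. srv N j l)"
  have nonneg: "0 \<le> norm_const N j * ?a n" for n
    by (intro mult_nonneg_nonneg less_imp_le[OF norm_const_pos] load_term_nonneg)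
  thus "0 \<le> norm_const N j * load N j ^ n / (\<Prod>l=1..n. srv N j l)" for n
    by simp
  have "(\<Sum>n. ennreal (norm_const N j * ?a n)) = ennreal (\<Sum>n. norm_const N j * ?a n)"
    by (rule suminf_ennreal2[OF nonneg summable_mult[OF finite_norm]])
  also have "(\<Sum>n. norm_const N j * ?a n) = norm_const N j * (\<Sum>n. ?a n)"
    by (rule suminf_mult[OF finite_norm])
  also have "\<dots> = 1" using norm_const_pos[of j] by (simp add: norm_const_def)
  finally show "(\<integral>\<^sup>+n. ennreal (norm_const N j * load N j ^ n / (\<Prod>l=1..n. srv N j l)) \<partial>count_space UNIV) = 1"
    by (simp add: nn_integral_count_space_nat)
qed

lemma pmf_customer:
  assumes load: "load N j > 0"
  shows "pmf (customer_pmf j) (i, s) = (if s \<in> {1..len N i} then alpha N j i s / load N j else 0)"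
proof -
  let ?f = "\<lambda>(i, s). if s \<in> {1..len N i} then alpha N j i s / load N j else 0"
  let ?A = "Sigma UNIV (\<lambda>i. {1..len N i})"
  have alpha: "0 \<le> alpha N j i s" for i s by (simp add: alpha_def less_imp_le[OF arr_pos])
  have "pmf (embed_pmf ?f) (i, s) = ?f (i, s)"
  proof (rule pmf_embed_pmf)
    show nonneg: "0 \<le> ?f c" for c using alpha load_nonneg[of j] by (auto simp: case_prod_beta)
    have "(\<integral>\<^sup>+c. ennreal (?f c) \<partial>count_space UNIV) = (\<Sum>c\<in>?A. ennreal (?f c))"
      by (rule nn_integral_count_space') (auto split: if_splits)
    also have "\<dots> = ennreal (\<Sum>c\<in>?A. ?f c)" by (rule sum_ennreal) (rule nonneg)
    also have "(\<Sum>c\<in>?A. ?f c) = (\<Sum>(i, s)\<in>?A. alpha N j i s / load N j)"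
      by (rule sum.cong) auto
    also have "\<dots> = (\<Sum>i\<in>UNIV. \<Sum>s=1..len N i. alpha N j i s / load N j)"
      by (rule sum.Sigma[symmetric]) auto
    also have "\<dots> = load N j / load N j" by (simp only: load_def sum_divide_distrib)
    also have "\<dots> = 1" using load by simp
    finally show "(\<integral>\<^sup>+c. ennreal (?f c) \<partial>count_space UNIV) = 1" by simp
  qed
  thus ?thesis by (simp add: customer_pmf_def)
qed

lemma pmf_node: "pmf (node_pmf j) xs = pmf (length_pmf j) (length xs) * (\<Prod>c\<leftarrow>xs. pmf (customer_pmf j) c)"
  unfolding node_pmf_def pmf_bind
  by (subst integral_measure_pmf_real[of "{length xs}"]) (auto simp: pmf_replicate split: if_splits)

lemma map_length_node_pmf: "map_pmf length (node_pmf j) = length_pmf j"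
proof -
  have "map_pmf length (replicate_pmf n p) = return_pmf n" for n and p :: "('i \<times> nat) pmf"
  proof -
    have "map_pmf length (replicate_pmf n p) = map_pmf (\<lambda>_. n) (replicate_pmf n p)"
      by (rule map_pmf_cong) (auto simp: set_replicate_pmf)
    thus ?thesis by simp
  qed
  thus ?thesis by (simp add: node_pmf_def map_bind_pmf bind_return_pmf')
qed

lemma load_pos:
  assumes "C \<in> states N" "c \<in> set (C j)"
  shows "0 < load N j" and "pmf (customer_pmf j) c = arr N (fst c) / load N j"
proof -
  obtain i s where c: "c = (i, s)" by fastforce
  have s: "s \<in> {1..len N i}" "route N i s = j" using assms c by (auto simp: states_def)
  have alpha: "0 \<le> alpha N j i s" for i s by (simp add: alpha_def less_imp_le[OF arr_pos])
  have "0 < arr N i" by (rule arr_pos)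
  also have "arr N i = alpha N j i s" using s by (simp add: alpha_def)
  also have "\<dots> \<le> (\<Sum>s=1..len N i. alpha N j i s)" by (rule member_le_sum) (use s alpha in auto)
  also have "\<dots> \<le> load N j"
    unfolding load_def by (rule member_le_sum[where f = "\<lambda>i. \<Sum>s=1..len N i. alpha N j i s"]) (use alpha in \<open>auto intro: sum_nonneg\<close>)
  finally show load: "0 < load N j" .
  show "pmf (customer_pmf j) c = arr N (fst c) / load N j"
    using s by (simp add: c pmf_customer[OF load] alpha_def)
qed

text \<open>The powers of the load in the queue length distribution cancel against the denominators of the
  customer distributions.\<close>

lemma pmf_node_state:
  assumes C: "C \<in> states N"
  shows "pmf (node_pmf j) (C j) =
    norm_const N j * ((\<Prod>c\<leftarrow>C j. arr N (fst c)) / (\<Prod>l=1..queue_length C j. srv N j l))"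
proof -
  have "load N j ^ length xs * (\<Prod>c\<leftarrow>xs. pmf (customer_pmf j) c) = (\<Prod>c\<leftarrow>xs. arr N (fst c))"
    if "set xs \<subseteq> set (C j)" for xs
    using that
  proof (induction xs)
    case (Cons c xs)
    hence "load N j * pmf (customer_pmf j) c = arr N (fst c)"
      using load_pos[OF C, of c j] by simp
    thus ?case using Cons by (simp add: mult.left_commute mult.assoc)
  qed simp
  from this[of "C j"] show ?thesis by (simp add: pmf_node pmf_length)
qed

lemma pmf_equilibrium_prod: "pmf equilibrium_pmf C = (\<Prod>j\<in>UNIV. pmf (node_pmf j) (C j))"
  unfolding equilibrium_pmf_def by (rule pmf_Pi') auto

lemma pmf_equilibrium:
  assumes "C \<in> states N"
  shows "pmf equilibrium_pmf C = (\<Prod>j\<in>UNIV. norm_const N j) * equilibrium_weight N C"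
  unfolding pmf_equilibrium_prod equilibrium_weight_def pmf_node_state[OF assms] by (rule prod.distrib)

text \<open>An entry that is not allowed at its node has probability 0 if the load is positive; if the load is 0,
  all nonempty lists have probability 0.\<close>

lemma set_equilibrium_pmf: "set_pmf equilibrium_pmf \<subseteq> states N"
proof
  fix C assume "C \<in> set_pmf equilibrium_pmf"
  hence nz: "pmf (node_pmf j) (C j) \<noteq> 0" for j
    by (auto simp: set_pmf_iff pmf_equilibrium_prod)
  have "s \<in> {1..len N i} \<and> route N i s = j" if mem: "(i, s) \<in> set (C j)" for i s j
  proof -
    have "load N j \<noteq> 0"
    proof
      assume "load N j = 0"
      moreover have "queue_length C j \<noteq> 0" using mem by auto
      ultimately have "pmf (length_pmf j) (queue_length C j) = 0" by (simp add: pmf_length)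
      with nz[of j] show False by (simp add: pmf_node)
    qed
    hence load: "0 < load N j" using load_nonneg[of j] by simp
    have "0 \<notin> (\<lambda>c. pmf (customer_pmf j) c) ` set (C j)"
      using nz[of j] by (auto simp: pmf_node prod_list_zero_iff)
    hence "pmf (customer_pmf j) (i, s) \<noteq> 0" using mem by force
    thus ?thesis by (auto simp: pmf_customer[OF load] alpha_def split: if_splits)
  qed
  thus "C \<in> states N" by (auto simp: states_def)
qed

lemma inflow_equilibrium_pmf:
  assumes y: "y \<in> states N"
  shows "inflow (pmf equilibrium_pmf) y = pmf equilibrium_pmf y * outrate y"
proof -
  have "inflow (pmf equilibrium_pmf) y = (\<Prod>j\<in>UNIV. norm_const N j) * inflow (equilibrium_weight N) y"
    unfolding inflow_def sum_distrib_left
    by (intro sum.cong refl) (auto simp: below_def pmf_equilibrium)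
  thus ?thesis by (simp add: equilibrium_balance[OF y] pmf_equilibrium[OF y])
qed

text \<open>The law of \<open>X t\<close> is subinvariant by \<open>stationary_subinvariant\<close>, the product form satisfies the balance
  equations, and there is only one such distribution.\<close>

theorem stationary_law:
  assumes X: "markov_process M (states N) (rate N) X" and st: "stationary_process M X" and t: "0 \<le> t"
  shows "measure_pmf equilibrium_pmf = distr M (count_space UNIV) (X t)"
proof -
  have M: "prob_space M" and count: "countable (states N)"
    using X by (auto simp: markov_process_def)
  have meas: "X u \<in> measurable M (count_space (states N))" if "0 \<le> u" for u
    using X that by (auto simp: markov_process_def)
  obtain P where P: "set_pmf P \<subseteq> states N" "measure_pmf P = distr M (count_space UNIV) (X t)"
    using law_as_pmf[OF M count meas[OF t]] by blast
  have pmf_P: "pmf P x = \<P>(\<omega> in M. X 0 \<omega> = x)" for x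
  proof -
    have "pmf P x = measure_pmf.prob P {y. y = x}" by (simp add: measure_pmf_single)
    also have "\<dots> = \<P>(\<omega> in M. X t \<omega> = x)" by (rule prob_eq_pmf[OF meas[OF t] P(2), symmetric])
    also have "\<dots> = \<P>(\<omega> in M. X 0 \<omega> = x)"
      using st[unfolded stationary_process_def, rule_format, of "{0}" t "\<lambda>_. x"] t by simp
    finally show ?thesis .
  qed
  have "P = equilibrium_pmf"
  proof (rule invariant_pmf_unique)
    show "set_pmf P \<subseteq> states N" by (rule P(1))
    show "inflow (pmf P) y \<le> pmf P y * outrate y" if y: "y \<in> states N" for y
    proof -
      let ?S = "below (Suc (population y))"
      have "(\<Sum>x\<in>?S - {y}. pmf P x * rate N x y) \<le> pmf P y * infsum (rate N y) (states N - {y})"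
        unfolding pmf_P by (rule stationary_subinvariant[OF X st _ _ y]) (auto simp: below_def finite_levels)
      moreover have "inflow (pmf P) y = pmf P y * rate N y y + (\<Sum>x\<in>?S - {y}. pmf P x * rate N x y)"
        unfolding inflow_def by (rule sum.remove) (use y in \<open>auto simp: below_def finite_levels\<close>)
      ultimately show ?thesis by (simp add: infsum_rate[OF y] right_diff_distrib)
    qed
    show "set_pmf equilibrium_pmf \<subseteq> states N" by (rule set_equilibrium_pmf)
    show "inflow (pmf equilibrium_pmf) y \<le> pmf equilibrium_pmf y * outrate y" if "y \<in> states N" for y
      using inflow_equilibrium_pmf[OF that] by simp
  qed (rule work_decreases)
  with P(2) show ?thesis by simp
qed

lemma map_node_equilibrium_pmf: "map_pmf (\<lambda>C. C j) equilibrium_pmf = node_pmf j"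
  by (simp add: equilibrium_pmf_def Pi_pmf_component)

lemma prob_queue_length:
  "measure_pmf.prob equilibrium_pmf {C. queue_length C j \<in> A} = measure_pmf.prob (length_pmf j) A"
  unfolding map_length_node_pmf[symmetric] map_node_equilibrium_pmf[symmetric]
  by (simp add: vimage_def)

text \<open>Given a queue length of at least \<open>l\<close>, the entry in position \<open>l\<close> is one of the independent draws,
  whatever the queue length is.\<close>

lemma prob_customer:
  assumes l: "1 \<le> l"
  shows "measure_pmf.prob equilibrium_pmf {C. customer C j l = c \<and> l \<le> queue_length C j} =
    pmf (customer_pmf j) c * measure_pmf.prob (length_pmf j) {l..}"
proof -
  have "emeasure (node_pmf j) {xs. l - 1 < length xs \<and> xs ! (l - 1) = c} =
      (\<integral>\<^sup>+n. ennreal (pmf (customer_pmf j) c) * indicator {l - 1<..} n \<partial>length_pmf j)"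
    by (simp add: node_pmf_def emeasure_replicate_pmf_nth)
  also have "\<dots> = ennreal (pmf (customer_pmf j) c) * emeasure (length_pmf j) {l - 1<..}"
    by (rule nn_integral_cmult_indicator) simp
  also have "{l - 1<..} = {l..}" using l by auto
  finally have "measure_pmf.prob (node_pmf j) {xs. l - 1 < length xs \<and> xs ! (l - 1) = c} =
      pmf (customer_pmf j) c * measure_pmf.prob (length_pmf j) {l..}"
    by (simp add: measure_pmf.emeasure_eq_measure ennreal_mult[symmetric])
  moreover have "(\<lambda>C :: ('i, 'j) state. C j) -` {xs. l - 1 < length xs \<and> xs ! (l - 1) = c} =
      {C. customer C j l = c \<and> l \<le> queue_length C j}"
    using l by (auto simp: customer_def)
  ultimately show ?thesis
    unfolding map_node_equilibrium_pmf[symmetric] by simp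
qed

lemma indep_queue_lengths:
  "prob_space.indep_vars (measure_pmf equilibrium_pmf) (\<lambda>_. count_space UNIV) (\<lambda>j C. queue_length C j) UNIV"
  unfolding equilibrium_pmf_def
  by (rule prob_space.indep_vars_compose2[OF prob_space_measure_pmf indep_vars_Pi_pmf]) auto

end


theorem corollary2p1:
  fixes N :: "('i::finite, 'j::finite) network"
    and M :: "'w measure"
    and X :: "real \<Rightarrow> 'w \<Rightarrow> ('i, 'j) state"
    and t :: real
  assumes network: "open_network N"
    and total_rate: "\<And>j n. n \<ge> 1 \<Longrightarrow> (\<Sum>l=1..n. srv N j l * vel N j n l) = srv N j n"
    and finite_norm: "\<And>j. summable (\<lambda>n. load N j ^ n / (\<Prod>l=1..n. srv N j l))"
    and markov: "markov_process M (states N) (rate N) X"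
    and stationary: "stationary_process M X"
    and t: "t \<ge> 0"
  shows "prob_space.indep_vars M (\<lambda>_. count_space UNIV) (\<lambda>j \<omega>. queue_length (X t \<omega>) j) UNIV \<and>
    (\<forall>j n. \<P>(\<omega> in M. queue_length (X t \<omega>) j = n) = norm_const N j * load N j ^ n / (\<Prod>l=1..n. srv N j l)) \<and>
    (\<forall>j l i s. 1 \<le> l \<and> 1 \<le> s \<and> s \<le> len N i \<longrightarrow>
       \<P>(\<omega> in M. customer (X t \<omega>) j l = (i, s) \<bar> l \<le> queue_length (X t \<omega>) j) = alpha N j i s / load N j)"
proof (intro conjI allI impI)
  interpret stable_network N by standard (fact network total_rate finite_norm)+
  have M: "prob_space M" and X: "X t \<in> measurable M (count_space (states N))"
    using markov t by (auto simp: markov_process_def)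
  note law = stationary_law[OF markov stationary t]
  note prob = prob_eq_pmf[OF X law]
  show "prob_space.indep_vars M (\<lambda>_. count_space UNIV) (\<lambda>j \<omega>. queue_length (X t \<omega>) j) UNIV"
    by (rule indep_vars_if_indep_vars_law[OF M X law indep_queue_lengths]) simp
  fix j :: 'j
  show "\<P>(\<omega> in M. queue_length (X t \<omega>) j = n) = norm_const N j * load N j ^ n / (\<Prod>l=1..n. srv N j l)" for n
    using prob[of "\<lambda>C. queue_length C j = n"] prob_queue_length[of j "{n}"]
    by (simp add: measure_pmf_single pmf_length)
  fix l s :: nat and i :: 'i
  assume "1 \<le> l \<and> 1 \<le> s \<and> s \<le> len N i"
  hence l: "1 \<le> l" and s: "s \<in> {1..len N i}" by auto
  let ?q = "measure_pmf.prob (length_pmf j) {l..}"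
  have cond: "\<P>(\<omega> in M. customer (X t \<omega>) j l = (i, s) \<bar> l \<le> queue_length (X t \<omega>) j) =
      pmf (customer_pmf j) (i, s) * ?q / ?q"
    unfolding cond_prob_def prob[of "\<lambda>C. customer C j l = (i, s) \<and> l \<le> queue_length C j"] prob_customer[OF l]
      prob[of "\<lambda>C. l \<le> queue_length C j"] using prob_queue_length[of j "{l..}"] by simp
  show "\<P>(\<omega> in M. customer (X t \<omega>) j l = (i, s) \<bar> l \<le> queue_length (X t \<omega>) j) = alpha N j i s / load N j"
  proof (cases "load N j = 0")
    case True
    \<comment> \<open>The node is always empty, and both sides are quotients by 0.\<close>
    have "?q = measure_pmf.prob (length_pmf j) {}"
      by (rule measure_prob_cong_0) (use True l in \<open>auto simp: pmf_length\<close>)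
    thus ?thesis using True by (simp add: cond)
  next
    case False
    hence load: "0 < load N j" using load_nonneg[of j] by simp
    have "0 < pmf (length_pmf j) l"
      unfolding pmf_length
      by (intro divide_pos_pos mult_pos_pos zero_less_power norm_const_pos load prod_pos) (auto intro: srv_pos)
    also have "\<dots> = measure_pmf.prob (length_pmf j) {l}" by (simp add: measure_pmf_single)
    also have "\<dots> \<le> ?q" by (rule measure_pmf.finite_measure_mono) auto
    finally have "?q \<noteq> 0" by simp
    thus ?thesis using s by (simp add: cond pmf_customer[OF load])
  qed
qed

end
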